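(* Assume in addition $J\in L^2(\mathbb{R}^N)$ and let $h\in L^1(\mathbb{R}^N\setminus\Omega)$. The stationary problem $$0=\int_\Omega J(x-y)(\varphi(y)-\varphi(x))\,dy+\int_{\mathbb{R}^N\setminus\Omega}J(x-y)h(y)\,dy,\qquad x\in\Omega,$$ has a solution $\varphi\in L^2(\Omega)$ if and only if $$\int_\Omega\int_{\mathbb{R}^N\setminus\Omega}J(x-y)h(y)\,dy\,dx=0.$$ Moreover, any two solutions differ by an additive constant.
   Context: Standing assumptions: $\Omega\subset\mathbb{R}^N$ bounded, connected, smooth; $J\ge0$ symmetric, $\int J=1$, $J>0$ on $B(0,d)$, $J=0$ outside $B(0,d)$. *)

theory Defs
  imports "HOL-Analysis.Analysis"
begin

fun Ck_on :: "nat \<Rightarrow> 'a::euclidean_space set \<Rightarrow> ('a \<Rightarrow> real) \<Rightarrow> bool" where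
  "Ck_on 0 U f = continuous_on U f"
| "Ck_on (Suc k) U f =
     (continuous_on U f \<and> f differentiable_on U \<and>
      (\<forall>v. Ck_on k U (\<lambda>x. frechet_derivative f (at x) v)))"

definition smooth_on :: "'a::euclidean_space set \<Rightarrow> ('a \<Rightarrow> real) \<Rightarrow> bool" where
  "smooth_on U f \<longleftrightarrow> (\<forall>k. Ck_on k U f)"

definition smooth_domain :: "'a::euclidean_space set \<Rightarrow> bool" where
  "smooth_domain \<Omega> \<longleftrightarrow> open \<Omega> \<and>
     (\<forall>p\<in>frontier \<Omega>. \<exists>U \<psi>. open U \<and> p \<in> U \<and> smooth_on U \<psi> \<and>
        (\<forall>x\<in>U. \<psi> x = 0 \<longrightarrow> frechet_derivative \<psi> (at x) \<noteq> (\<lambda>v. 0)) \<and>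
        \<Omega> \<inter> U = {x\<in>U. \<psi> x < 0})"

definition L2_on :: "'a::euclidean_space set \<Rightarrow> ('a \<Rightarrow> real) \<Rightarrow> bool" where
  "L2_on S f \<longleftrightarrow> set_borel_measurable lborel S f \<and>
                  set_integrable lborel S (\<lambda>x. (f x)\<^sup>2)"

definition stationary_solution ::
  "'a::euclidean_space set \<Rightarrow> ('a \<Rightarrow> real) \<Rightarrow> ('a \<Rightarrow> real) \<Rightarrow> ('a \<Rightarrow> real) \<Rightarrow> bool" where
  "stationary_solution \<Omega> J h \<phi> \<longleftrightarrow> L2_on \<Omega> \<phi> \<and>
     (AE x in lborel. x \<in> \<Omega> \<longrightarrow>
        0 = (LINT y:\<Omega>|lborel. J (x - y) * (\<phi> y - \<phi> x))
          + (LINT y:(- \<Omega>)|lborel. J (x - y) * h y))"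

end

theory Submission
  imports Defs
begin

text \<open>
  With \<open>L u x = \<integral>J(x - y)(u x - u y) dy\<close> over \<open>\<Omega>\<close>, the problem reads \<open>L \<phi> = g\<close>, where
  \<open>g x\<close> is the integral of \<open>J(x - y) h y\<close> over the complement of \<open>\<Omega>\<close>; \<open>g\<close> is square
  integrable because \<open>J\<close> is and \<open>h\<close> is integrable. By symmetry of \<open>J\<close>, \<open>\<integral>L u = 0\<close> and
  \<open>\<integral>u L u = E u / 2\<close> with \<open>E u = \<integral>\<integral>J(x - y)(u x - u y)\<^sup>2\<close>; moreover \<open>\<integral>(L u)\<^sup>2 \<le> E u\<close>.
  The core is the Poincare inequality \<open>\<integral>\<integral>(u x - u y)\<^sup>2 \<le> C E u\<close>. It holds on subsets of
  diameter less than \<open>d\<close> by averaging over intermediate points, it passes from two sets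
  that meet in positive measure to their union, and finitely many small pieces cover the
  connected set \<open>\<Omega>\<close>. Consequently \<open>L u = 0\<close> forces \<open>u\<close> to be constant, and
  \<open>u \<mapsto> u - L u / 2\<close> is a strict \<open>L\<^sup>2\<close> contraction on mean-zero functions, so that
  half its Neumann series applied to \<open>g\<close> solves \<open>L \<phi> = g\<close> without any compactness argument.
\<close>

section \<open>Integration lemmas\<close>

text \<open>The integral of \<open>w * (v - m)^2\<close> is nonnegative for every constant
  \<open>m\<close>; the choice \<open>m = (integral of w * v) / c\<close> gives the bound. Allowing
  any \<open>c\<close> above the mass of \<open>w\<close> covers kernels of mass less than 1 and a
  weight that vanishes.\<close>

lemma weighted_Cauchy_Schwarz:
  fixes w v :: "'a \<Rightarrow> real"
  assumes w_nonneg: "\<And>y. y \<in> space M \<Longrightarrow> 0 \<le> w y"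
    and w: "integrable M w" and wv: "integrable M (\<lambda>y. w y * v y)"
    and wv2: "integrable M (\<lambda>y. w y * (v y)\<^sup>2)"
    and w_le: "(\<integral>y. w y \<partial>M) \<le> c" and c: "0 < c"
  shows "(\<integral>y. w y * v y \<partial>M)\<^sup>2 \<le> c * (\<integral>y. w y * (v y)\<^sup>2 \<partial>M)"
proof -
  define m where "m = (\<integral>y. w y * v y \<partial>M) / c"
  have m: "(\<integral>y. w y * v y \<partial>M) = c * m"
    using c by (simp add: m_def)
  have "0 \<le> (\<integral>y. w y * (v y - m)\<^sup>2 \<partial>M)"
    using w_nonneg by (intro integral_nonneg_AE) auto
  also have "\<dots> = (\<integral>y. w y * (v y)\<^sup>2 - 2 * m * (w y * v y) + m\<^sup>2 * w y \<partial>M)"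
    by (simp add: power2_eq_square algebra_simps)
  also have "\<dots> = (\<integral>y. w y * (v y)\<^sup>2 \<partial>M) - 2 * m * (\<integral>y. w y * v y \<partial>M) + m\<^sup>2 * (\<integral>y. w y \<partial>M)"
    using w wv wv2 by simp
  also have "\<dots> \<le> (\<integral>y. w y * (v y)\<^sup>2 \<partial>M) - 2 * m * (\<integral>y. w y * v y \<partial>M) + m\<^sup>2 * c"
    using w_le by (simp add: mult_left_mono)
  finally have "c * m\<^sup>2 \<le> (\<integral>y. w y * (v y)\<^sup>2 \<partial>M)"
    unfolding m by (simp add: power2_eq_square algebra_simps)
  then have "c * (c * m\<^sup>2) \<le> c * (\<integral>y. w y * (v y)\<^sup>2 \<partial>M)"
    using c by simp
  then show ?thesis
    unfolding m by (simp add: power2_eq_square algebra_simps)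
qed

lemma L2_diff:
  fixes u v :: "'a \<Rightarrow> real"
  assumes [measurable]: "u \<in> borel_measurable M" "v \<in> borel_measurable M"
    and u: "integrable M (\<lambda>x. (u x)\<^sup>2)" and v: "integrable M (\<lambda>x. (v x)\<^sup>2)"
  shows "integrable M (\<lambda>x. (u x - v x)\<^sup>2)"
proof (rule Bochner_Integration.integrable_bound)
  show "integrable M (\<lambda>x. 2 * (u x)\<^sup>2 + 2 * (v x)\<^sup>2)"
    using u v by simp
  have "(u x - v x)\<^sup>2 \<le> 2 * (u x)\<^sup>2 + 2 * (v x)\<^sup>2" for x
    using zero_le_power2[of "u x + v x"] by (simp add: power2_eq_square algebra_simps)
  then show "AE x in M. norm ((u x - v x)\<^sup>2) \<le> norm (2 * (u x)\<^sup>2 + 2 * (v x)\<^sup>2)"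
    by (intro AE_I2) simp
qed measurable

text \<open>Tonelli: the sum of the integrals is the integral of the extended-valued sum, so
  finiteness of the former makes the latter finite almost everywhere. This supplies the dominating
  function of the Neumann series.\<close>

lemma AE_summable_integral:
  fixes f :: "nat \<Rightarrow> 'a \<Rightarrow> real"
  assumes int: "\<And>n. integrable M (f n)" and nonneg: "\<And>n x. 0 \<le> f n x"
    and sum: "summable (\<lambda>n. \<integral>x. f n x \<partial>M)"
  shows "AE x in M. summable (\<lambda>n. f n x)" "integrable M (\<lambda>x. \<Sum>n. f n x)"
proof -
  have [measurable]: "f n \<in> borel_measurable M" for n
    using int by auto
  have "(\<integral>\<^sup>+x. (\<Sum>n. ennreal (f n x)) \<partial>M) = (\<Sum>n. \<integral>\<^sup>+x. ennreal (f n x) \<partial>M)"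
    by (intro nn_integral_suminf) auto
  also have "\<dots> = (\<Sum>n. ennreal (\<integral>x. f n x \<partial>M))"
    by (simp add: nn_integral_eq_integral int nonneg)
  also have "\<dots> \<noteq> \<infinity>"
    unfolding infinity_ennreal_def
    by (rule ennreal_suminf_neq_top[OF sum]) (rule Bochner_Integration.integral_nonneg[OF nonneg])
  finally have "AE x in M. (\<Sum>n. ennreal (f n x)) \<noteq> \<infinity>"
    by (intro nn_integral_PInf_AE) auto
  then show ae: "AE x in M. summable (\<lambda>n. f n x)"
    by eventually_elim (auto intro!: summable_suminf_not_top nonneg)
  show "integrable M (\<lambda>x. \<Sum>n. f n x)"
    using ae sum nonneg by (intro integrable_suminf int) auto
qed

section \<open>Translations and convolutions for Lebesgue measure\<close>

lemma nn_integral_lborel_translate: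
  fixes f :: "'a::euclidean_space \<Rightarrow> ennreal"
  assumes "f \<in> borel_measurable borel"
  shows "(\<integral>\<^sup>+y. f (c + y) \<partial>lborel) = (\<integral>\<^sup>+y. f y \<partial>lborel)"
proof -
  have "(\<integral>\<^sup>+y. f y \<partial>lborel) = (\<integral>\<^sup>+y. f y \<partial>distr lborel borel ((+) c))"
    by (simp add: lborel_distr_plus)
  also have "\<dots> = (\<integral>\<^sup>+y. f (c + y) \<partial>lborel)"
    using assms by (intro nn_integral_distr) auto
  finally show ?thesis by simp
qed

lemma integrable_lborel_translate:
  fixes f :: "'a::euclidean_space \<Rightarrow> real"
  assumes "integrable lborel f"
  shows "integrable lborel (\<lambda>y. f (c + y))" "(\<integral>y. f (c + y) \<partial>lborel) = (\<integral>y. f y \<partial>lborel)"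
proof -
  have f: "f \<in> borel_measurable borel"
    using assms by auto
  show "integrable lborel (\<lambda>y. f (c + y))"
    using assms f integrable_distr_eq[of "(+) c" lborel borel f] by (simp add: lborel_distr_plus)
  show "(\<integral>y. f (c + y) \<partial>lborel) = (\<integral>y. f y \<partial>lborel)"
    using f integral_distr[of "(+) c" lborel borel f] by (simp add: lborel_distr_plus)
qed

lemma emeasure_lborel_translate:
  fixes N :: "'a::euclidean_space set"
  assumes "N \<in> sets borel"
  shows "{z. z - x \<in> N} \<in> sets borel" "emeasure lborel {z. z - x \<in> N} = emeasure lborel N"
proof -
  have eq: "{z. z - x \<in> N} = (+) (- x) -` N \<inter> space borel"
    by (auto simp: algebra_simps)
  show "{z. z - x \<in> N} \<in> sets borel"
    unfolding eq using assms by (intro measurable_sets) auto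
  show "emeasure lborel {z. z - x \<in> N} = emeasure lborel N"
    unfolding eq using emeasure_distr[of "(+) (- x)" lborel borel N] assms
    by (simp add: lborel_distr_plus)
qed

lemma emeasure_lborel_open_pos:
  fixes U :: "'a::euclidean_space set"
  assumes "open U" "U \<noteq> {}"
  shows "0 < emeasure lborel U"
proof -
  obtain x r where r: "0 < r" "ball x r \<subseteq> U"
    using assms by (meson all_not_in_conv open_contains_ball)
  have "0 < measure lborel (ball x r)"
    using r(1) by (rule content_ball_pos)
  then have "0 < emeasure lborel (ball x r)"
    by (simp add: measure_def enn2real_positive_iff)
  also have "\<dots> \<le> emeasure lborel U"
    using r(2) assms(1) by (intro emeasure_mono) auto
  finally show ?thesis .
qed

lemma convolution_integrable:
  fixes F H :: "'a::euclidean_space \<Rightarrow> real"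
  assumes F: "integrable lborel F" and H: "integrable lborel H"
  shows "integrable (lborel \<Otimes>\<^sub>M lborel) (\<lambda>p. F (fst p - snd p) * H (snd p))"
proof -
  have [measurable]: "F \<in> borel_measurable borel" "H \<in> borel_measurable borel"
    using F H by auto
  have F': "integrable lborel (\<lambda>y. F (y - x))" for x
    using integrable_lborel_translate(1)[OF F, of "- x"] by simp
  have "(\<integral>y. norm (F (y - x) * H x) \<partial>lborel) = (\<integral>y. \<bar>F y\<bar> \<partial>lborel) * \<bar>H x\<bar>" for x
    using integrable_lborel_translate(2)[of "\<lambda>y. \<bar>F y\<bar>" "- x"] F by (simp add: abs_mult)
  \<comment> \<open>Fubini integrates the second coordinate first. With the roles exchanged, that
    variable occurs only in \<open>F\<close>, and translation invariance evaluates the inner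
    integral; the coordinates are swapped back afterwards.\<close>
  then have "integrable (lborel \<Otimes>\<^sub>M lborel) (\<lambda>p. F (snd p - fst p) * H (fst p))"
    using F' H by (intro lborel_pair.Fubini_integrable) auto
  from lborel_pair.integrable_product_swap[OF this] show ?thesis
    by (simp add: case_prod_unfold)
qed

text \<open>Young's inequality for an L2 and an L1 function: Cauchy-Schwarz with weight
  \<open>\<bar>H\<bar>\<close> reduces the square to the convolution of the integrable functions
  \<open>(J x)\<^sup>2\<close> and \<open>\<bar>H\<bar>\<close>.\<close>

lemma convolution_L2:
  fixes J H :: "'a::euclidean_space \<Rightarrow> real"
  assumes J: "integrable lborel J" and J2: "integrable lborel (\<lambda>x. (J x)\<^sup>2)"
    and H: "integrable lborel H"
  shows "integrable lborel (\<lambda>x. (\<integral>y. J (x - y) * H y \<partial>lborel)\<^sup>2)"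
proof -
  have [measurable]: "J \<in> borel_measurable borel" "H \<in> borel_measurable borel"
    using J H by auto
  \<comment> \<open>The added 1 keeps \<open>c\<close> positive even if \<open>H\<close> vanishes
    almost everywhere.\<close>
  define c where "c = (\<integral>y. \<bar>H y\<bar> \<partial>lborel) + 1"
  have c: "0 < c"
    unfolding c_def by (intro add_nonneg_pos integral_nonneg_AE) auto
  have i2: "integrable (lborel \<Otimes>\<^sub>M lborel) (\<lambda>p. (J (fst p - snd p))\<^sup>2 * \<bar>H (snd p)\<bar>)"
    using convolution_integrable[OF J2 integrable_abs[OF H]] .
  have "AE x in lborel. (\<integral>y. J (x - y) * H y \<partial>lborel)\<^sup>2
      \<le> c * (\<integral>y. (J (x - y))\<^sup>2 * \<bar>H y\<bar> \<partial>lborel)"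
    using lborel_pair.AE_integrable_fst'[OF i2]
      lborel_pair.AE_integrable_fst'[OF convolution_integrable[OF J H]]
  proof eventually_elim
    case (elim x)
    \<comment> \<open>The sign of \<open>H\<close> moves into the other factor, which leaves a
      nonnegative weight.\<close>
    have e1: "\<bar>H y\<bar> * (J (x - y) * sgn (H y)) = J (x - y) * H y" for y
      by (simp add: mult.left_commute abs_mult_sgn)
    have e2: "\<bar>H y\<bar> * (J (x - y) * sgn (H y))\<^sup>2 = (J (x - y))\<^sup>2 * \<bar>H y\<bar>" for y
      by (cases "H y = 0") (simp_all add: power_mult_distrib sgn_if)
    show ?case
      using weighted_Cauchy_Schwarz[of lborel "\<lambda>y. \<bar>H y\<bar>" "\<lambda>y. J (x - y) * sgn (H y)" c]
        elim H c unfolding e1 e2 by (simp add: c_def)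
  qed
  then have le: "AE x in lborel. norm ((\<integral>y. J (x - y) * H y \<partial>lborel)\<^sup>2)
      \<le> norm (c * (\<integral>y. (J (x - y))\<^sup>2 * \<bar>H y\<bar> \<partial>lborel))"
    by eventually_elim simp
  show ?thesis
  proof (rule Bochner_Integration.integrable_bound[OF _ _ le])
    show "integrable lborel (\<lambda>x. c * (\<integral>y. (J (x - y))\<^sup>2 * \<bar>H y\<bar> \<partial>lborel))"
      using lborel_pair.integrable_fst'[OF i2] by simp
  qed measurable
qed

section \<open>Nonlocal operators with a symmetric kernel\<close>

text \<open>A kernel restricted to a domain loses the mass falling outside it, so
  \<open>k_mass\<close> bounds the mass by 1 instead of fixing it. As a nonnegative integral, the
  bound also yields integrability of \<open>k x\<close>.\<close>

locale symmetric_kernel = finite_measure M for M :: "'a measure" +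
  fixes k :: "'a \<Rightarrow> 'a \<Rightarrow> real"
  assumes k_measurable [measurable]: "(\<lambda>p. k (fst p) (snd p)) \<in> borel_measurable (M \<Otimes>\<^sub>M M)"
    and k_nonneg: "\<And>x y. 0 \<le> k x y"
    and k_sym: "\<And>x y. k x y = k y x"
    and k_mass: "\<And>x. x \<in> space M \<Longrightarrow> (\<integral>\<^sup>+y. ennreal (k x y) \<partial>M) \<le> 1"
begin

sublocale pair: pair_sigma_finite M M ..

text \<open>The sign is opposite to that of the integral in the stationary problem, which makes the
  quadratic form of \<open>L\<close> nonnegative.\<close>

definition L :: "('a \<Rightarrow> real) \<Rightarrow> 'a \<Rightarrow> real" where
  "L u x = (\<integral>y. k x y * (u x - u y) \<partial>M)"

text \<open>With values in \<open>ennreal\<close>, inequalities for the energy make sense for every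
  measurable \<open>u\<close>, without integrability conditions.\<close>

definition energy :: "('a \<Rightarrow> real) \<Rightarrow> ennreal" where
  "energy u = (\<integral>\<^sup>+x. \<integral>\<^sup>+y. ennreal (k x y * (u x - u y)\<^sup>2) \<partial>M \<partial>M)"

lemma k_measurable2 [measurable]:
  assumes "f \<in> measurable N M" "g \<in> measurable N M"
  shows "(\<lambda>x. k (f x) (g x)) \<in> borel_measurable N"
  using measurable_compose[OF measurable_Pair[OF assms] k_measurable] by simp

lemma k_integrable:
  assumes "x \<in> space M"
  shows "integrable M (k x)" "(\<integral>y. k x y \<partial>M) \<le> 1"
proof -
  have [measurable]: "k x \<in> borel_measurable M"
    using assms by measurable
  show i: "integrable M (k x)"
    using le_less_trans[OF k_mass[OF assms], of \<infinity>] k_nonneg by (intro integrableI_bounded) auto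
  show "(\<integral>y. k x y \<partial>M) \<le> 1"
    using k_mass[OF assms] i k_nonneg by (simp add: nn_integral_eq_integral)
qed

text \<open>Integrating out the variable absent from \<open>u\<close> costs a factor of at most 1 by
  \<open>k_mass\<close>; symmetry of \<open>k\<close> transfers the result to the other
  variable.\<close>

lemma integrable_weight:
  assumes [measurable]: "u \<in> borel_measurable M" and u: "integrable M u"
  shows "integrable (M \<Otimes>\<^sub>M M) (\<lambda>p. k (fst p) (snd p) * u (fst p))"
    and "integrable (M \<Otimes>\<^sub>M M) (\<lambda>p. k (fst p) (snd p) * u (snd p))"
proof -
  show 1: "integrable (M \<Otimes>\<^sub>M M) (\<lambda>p. k (fst p) (snd p) * u (fst p))"
  proof (rule integrableI_bounded)
    have "(\<integral>\<^sup>+p. ennreal (norm (k (fst p) (snd p) * u (fst p))) \<partial>(M \<Otimes>\<^sub>M M))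
        = (\<integral>\<^sup>+x. \<integral>\<^sup>+y. ennreal (norm (k x y * u x)) \<partial>M \<partial>M)"
      by (subst nn_integral_fst[symmetric]) (auto simp: split_beta)
    also have "\<dots> = (\<integral>\<^sup>+x. ennreal \<bar>u x\<bar> * (\<integral>\<^sup>+y. ennreal (k x y) \<partial>M) \<partial>M)"
      by (intro nn_integral_cong, subst nn_integral_cmult[symmetric])
         (auto simp: abs_mult k_nonneg ennreal_mult mult.commute)
    also have "\<dots> \<le> (\<integral>\<^sup>+x. ennreal \<bar>u x\<bar> * 1 \<partial>M)"
      by (intro nn_integral_mono mult_left_mono k_mass) auto
    also have "\<dots> < \<infinity>"
      using u by (simp add: integrable_iff_bounded)
    finally show "(\<integral>\<^sup>+p. ennreal (norm (k (fst p) (snd p) * u (fst p))) \<partial>(M \<Otimes>\<^sub>M M)) < \<infinity>" .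
  qed measurable
  show "integrable (M \<Otimes>\<^sub>M M) (\<lambda>p. k (fst p) (snd p) * u (snd p))"
    using pair.integrable_product_swap[OF 1] by (simp add: case_prod_unfold k_sym)
qed

text \<open>One domination argument for the three integrands below; the constant term is integrable
  against the kernel because \<open>M\<close> is finite.\<close>

lemma integrable_kernel_bound:
  assumes [measurable]: "u \<in> borel_measurable M" and u: "integrable M (\<lambda>x. (u x)\<^sup>2)"
    and [measurable]: "(\<lambda>p. f (fst p) (snd p)) \<in> borel_measurable (M \<Otimes>\<^sub>M M)"
    and le: "\<And>x y. \<bar>f x y\<bar> \<le> 2 * (1 + (u x)\<^sup>2 + (u y)\<^sup>2)"
  shows "integrable (M \<Otimes>\<^sub>M M) (\<lambda>p. k (fst p) (snd p) * f (fst p) (snd p))"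
proof (rule Bochner_Integration.integrable_bound)
  show "integrable (M \<Otimes>\<^sub>M M) (\<lambda>p. 2 * (k (fst p) (snd p) * 1
      + k (fst p) (snd p) * (u (fst p))\<^sup>2 + k (fst p) (snd p) * (u (snd p))\<^sup>2))"
    using u by (intro integrable_mult_right Bochner_Integration.integrable_add integrable_weight) auto
  have "\<bar>k x y * f x y\<bar> \<le> 2 * (k x y * 1 + k x y * (u x)\<^sup>2 + k x y * (u y)\<^sup>2)" for x y
    using mult_left_mono[OF le[of x y] k_nonneg[of x y]]
    by (simp add: abs_mult k_nonneg algebra_simps)
  then show "AE p in M \<Otimes>\<^sub>M M. norm (k (fst p) (snd p) * f (fst p) (snd p))
      \<le> norm (2 * (k (fst p) (snd p) * 1
      + k (fst p) (snd p) * (u (fst p))\<^sup>2 + k (fst p) (snd p) * (u (snd p))\<^sup>2))"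
    by (intro AE_I2) (simp add: k_nonneg abs_of_nonneg)
qed measurable

section \<open>Integral identities and bounds for \<open>L u\<close> with square-integrable
  \<open>u\<close>\<close>

context
  fixes u :: "'a \<Rightarrow> real"
  assumes u_measurable [measurable]: "u \<in> borel_measurable M"
    and u_L2: "integrable M (\<lambda>x. (u x)\<^sup>2)"
begin


lemma integrable_kernel_diff:
  "integrable (M \<Otimes>\<^sub>M M) (\<lambda>p. k (fst p) (snd p) * (u (fst p) - u (snd p)))"
proof (rule integrable_kernel_bound[OF u_measurable u_L2])
  fix x y
  have "2 * \<bar>t\<bar> \<le> 1 + t\<^sup>2" for t :: real
    using zero_le_power2[of "\<bar>t\<bar> - 1"] by (simp add: power2_diff)
  from this[of "u x"] this[of "u y"]
  show "\<bar>u x - u y\<bar> \<le> 2 * (1 + (u x)\<^sup>2 + (u y)\<^sup>2)"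
    using abs_triangle_ineq4[of "u x" "u y"] zero_le_power2[of "u x"] zero_le_power2[of "u y"]
    by argo
qed measurable

lemma integrable_kernel_mult_diff:
  "integrable (M \<Otimes>\<^sub>M M) (\<lambda>p. k (fst p) (snd p) * (u (fst p) * (u (fst p) - u (snd p))))"
proof (rule integrable_kernel_bound[OF u_measurable u_L2])
  fix x y
  have "2 * (u x * u y) \<le> u x * u x + u y * u y" "- 2 * (u x * u y) \<le> u x * u x + u y * u y"
    using zero_le_power2[of "u x + u y"] zero_le_power2[of "u x - u y"]
    by (simp_all add: power2_eq_square algebra_simps)
  moreover have "\<bar>s - p\<bar> \<le> 2 * (1 + s + t)"
    if "2 * p \<le> s + t" "- 2 * p \<le> s + t" "0 \<le> s" "0 \<le> t" for p s t :: real
    using that by argo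
  ultimately show "\<bar>u x * (u x - u y)\<bar> \<le> 2 * (1 + (u x)\<^sup>2 + (u y)\<^sup>2)"
    unfolding right_diff_distrib power2_eq_square by simp
qed measurable

lemma integrable_kernel_diff_square:
  "integrable (M \<Otimes>\<^sub>M M) (\<lambda>p. k (fst p) (snd p) * (u (fst p) - u (snd p))\<^sup>2)"
proof (rule integrable_kernel_bound[OF u_measurable u_L2])
  fix x y
  show "\<bar>(u x - u y)\<^sup>2\<bar> \<le> 2 * (1 + (u x)\<^sup>2 + (u y)\<^sup>2)"
    using zero_le_power2[of "u x + u y"] zero_le_power2[of "u x"] zero_le_power2[of "u y"]
    unfolding abs_power2 by (simp add: power2_eq_square algebra_simps)
qed measurable

lemma L_measurable [measurable]: "L u \<in> borel_measurable M"
  unfolding L_def by measurable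

lemma L_integrable: "integrable M (L u)"
  using pair.integrable_fst'[OF integrable_kernel_diff] by (simp add: L_def[abs_def])

text \<open>Exchanging the two variables reverses the sign of the double integral, by symmetry of
  \<open>k\<close>.\<close>

lemma integral_L: "(\<integral>x. L u x \<partial>M) = 0"
proof -
  define I where "I = (\<integral>p. k (fst p) (snd p) * (u (fst p) - u (snd p)) \<partial>(M \<Otimes>\<^sub>M M))"
  have "I = (\<integral>(x, y). k y x * (u y - u x) \<partial>(M \<Otimes>\<^sub>M M))"
    unfolding I_def by (subst pair.integral_product_swap[symmetric]) (auto simp: case_prod_unfold)
  also have "\<dots> = (\<integral>p. - (k (fst p) (snd p) * (u (fst p) - u (snd p))) \<partial>(M \<Otimes>\<^sub>M M))"
    by (simp add: case_prod_unfold k_sym[of "snd _"] algebra_simps)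
  also have "\<dots> = - I"
    unfolding I_def by (rule integral_minus)
  finally have "I = 0" by simp
  then show ?thesis
    using pair.integral_fst'[OF integrable_kernel_diff] by (simp add: I_def L_def)
qed

text \<open>The real-valued form of \<open>energy\<close>, finite because \<open>u\<close> is square
  integrable, so that it can be subtracted in estimates.\<close>

definition real_energy :: real where
  "real_energy = (\<integral>p. k (fst p) (snd p) * (u (fst p) - u (snd p))\<^sup>2 \<partial>(M \<Otimes>\<^sub>M M))"

lemma energy_eq: "energy u = ennreal real_energy"
proof -
  have "energy u = (\<integral>\<^sup>+p. ennreal (k (fst p) (snd p) * (u (fst p) - u (snd p))\<^sup>2) \<partial>(M \<Otimes>\<^sub>M M))"
    unfolding energy_def by (subst nn_integral_fst[symmetric]) auto
  also have "\<dots> = ennreal real_energy"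
    unfolding real_energy_def using integrable_kernel_diff_square k_nonneg
    by (intro nn_integral_eq_integral) auto
  finally show ?thesis .
qed

lemma real_energy_nonneg: "0 \<le> real_energy"
  unfolding real_energy_def using k_nonneg by (intro integral_nonneg_AE) auto

text \<open>Symmetrization: \<open>u x * (u x - u y)\<close> and its copy with \<open>x\<close> and
  \<open>y\<close> exchanged have the same weighted integral, and they add up to the square of the
  difference.\<close>

lemma integrable_mult_L: "integrable M (\<lambda>x. u x * L u x)"
  and integral_mult_L: "(\<integral>x. u x * L u x \<partial>M) = real_energy / 2"
proof -
  let ?f = "\<lambda>p. k (fst p) (snd p) * (u (fst p) * (u (fst p) - u (snd p)))"
  have eq: "(\<integral>y. ?f (x, y) \<partial>M) = u x * L u x" for x
    unfolding L_def by (subst integral_mult_right_zero[symmetric]) (simp add: algebra_simps)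
  show "integrable M (\<lambda>x. u x * L u x)"
    using pair.integrable_fst'[OF integrable_kernel_mult_diff] unfolding eq .
  define I where "I = integral\<^sup>L (M \<Otimes>\<^sub>M M) ?f"
  have swap: "I = (\<integral>p. k (fst p) (snd p) * (u (snd p) * (u (snd p) - u (fst p))) \<partial>(M \<Otimes>\<^sub>M M))"
    unfolding I_def by (subst pair.integral_product_swap[symmetric])
      (auto simp: case_prod_unfold k_sym[of "snd _"])
  have int': "integrable (M \<Otimes>\<^sub>M M) (\<lambda>p. k (fst p) (snd p) * (u (snd p) * (u (snd p) - u (fst p))))"
    using pair.integrable_product_swap[OF integrable_kernel_mult_diff]
    by (simp add: case_prod_unfold k_sym[of "snd _"])
  have "real_energy = (\<integral>p. ?f p + k (fst p) (snd p) * (u (snd p) * (u (snd p) - u (fst p))) \<partial>(M \<Otimes>\<^sub>M M))"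
    unfolding real_energy_def by (simp add: power2_eq_square algebra_simps)
  also have "\<dots> = I + I"
    using Bochner_Integration.integral_add[OF integrable_kernel_mult_diff int'] swap by (simp add: I_def)
  finally have "I = real_energy / 2" by simp
  then show "(\<integral>x. u x * L u x \<partial>M) = real_energy / 2"
    using pair.integral_fst'[OF integrable_kernel_mult_diff] unfolding eq I_def by simp
qed

text \<open>Cauchy-Schwarz with the weight \<open>k x\<close>, whose mass is at most 1, bounds the
  square pointwise; integration over \<open>x\<close> gives the energy.\<close>

lemma L_square_integrable: "integrable M (\<lambda>x. (L u x)\<^sup>2)"
  and L_square_le: "(\<integral>x. (L u x)\<^sup>2 \<partial>M) \<le> real_energy"
proof -
  let ?g = "\<lambda>x. \<integral>y. k x y * (u x - u y)\<^sup>2 \<partial>M"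
  have g: "integrable M ?g" "integral\<^sup>L M ?g = real_energy"
    using pair.integrable_fst'[OF integrable_kernel_diff_square] pair.integral_fst'[OF integrable_kernel_diff_square]
    by (simp_all add: real_energy_def)
  have le: "AE x in M. (L u x)\<^sup>2 \<le> ?g x"
    using pair.AE_integrable_fst'[OF integrable_kernel_diff] pair.AE_integrable_fst'[OF integrable_kernel_diff_square]
      AE_space
  proof eventually_elim
    case (elim x)
    then show ?case
      using weighted_Cauchy_Schwarz[of M "k x" "\<lambda>y. u x - u y" 1] k_nonneg k_integrable[of x]
      by (simp add: L_def)
  qed
  show i: "integrable M (\<lambda>x. (L u x)\<^sup>2)"
  proof (rule Bochner_Integration.integrable_bound[OF g(1)])
    show "AE x in M. norm ((L u x)\<^sup>2) \<le> norm (?g x)"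
      using le by eventually_elim simp
  qed measurable
  show "(\<integral>x. (L u x)\<^sup>2 \<partial>M) \<le> real_energy"
    using integral_mono_AE[OF i g(1) le] g(2) by simp
qed

end

section \<open>The relaxed iteration, spectral gap and Neumann series\<close>

definition T :: "('a \<Rightarrow> real) \<Rightarrow> 'a \<Rightarrow> real" where
  "T u x = u x - L u x / 2"

definition poincare :: "real \<Rightarrow> bool" where
  "poincare C \<longleftrightarrow> (\<forall>u\<in>borel_measurable M.
     (\<integral>\<^sup>+x. \<integral>\<^sup>+y. ennreal ((u x - u y)\<^sup>2) \<partial>M \<partial>M) \<le> ennreal C * energy u)"

context
  fixes u :: "'a \<Rightarrow> real"
  assumes u_measurable [measurable]: "u \<in> borel_measurable M"
    and u_L2: "integrable M (\<lambda>x. (u x)\<^sup>2)"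
begin

lemma u_integrable: "integrable M u"
  by (rule square_integrable_imp_integrable[OF u_measurable u_L2])

text \<open>Follows by expanding the square. For mean-zero \<open>u\<close> only the L2 norm
  remains, so \<open>poincare\<close> becomes a spectral gap: the energy bounds the L2 norm.\<close>

lemma variance_identity:
  "(\<integral>\<^sup>+x. \<integral>\<^sup>+y. ennreal ((u x - u y)\<^sup>2) \<partial>M \<partial>M)
    = ennreal (2 * measure M (space M) * (\<integral>x. (u x)\<^sup>2 \<partial>M) - 2 * (\<integral>x. u x \<partial>M)\<^sup>2)"
proof -
  have eq: "(\<integral>y. (u x - u y)\<^sup>2 \<partial>M)
      = measure M (space M) * (u x)\<^sup>2 - 2 * u x * (\<integral>y. u y \<partial>M) + (\<integral>y. (u y)\<^sup>2 \<partial>M)" for x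
  proof -
    have "(\<integral>y. (u x - u y)\<^sup>2 \<partial>M) = (\<integral>y. (u x)\<^sup>2 - 2 * u x * u y + (u y)\<^sup>2 \<partial>M)"
      by (simp add: power2_eq_square algebra_simps)
    then show ?thesis
      using u_L2 u_integrable by simp
  qed
  have int: "integrable M (\<lambda>y. (u x - u y)\<^sup>2)" for x
    using u_L2 u_integrable by (simp add: power2_diff)
  have 1: "integrable (M \<Otimes>\<^sub>M M) (\<lambda>p. (u (fst p) - u (snd p))\<^sup>2)"
    using u_L2 u_integrable int by (intro pair.Fubini_integrable) (auto simp: eq)
  have "(\<integral>\<^sup>+x. \<integral>\<^sup>+y. ennreal ((u x - u y)\<^sup>2) \<partial>M \<partial>M)
      = (\<integral>\<^sup>+x. ennreal (\<integral>y. (u x - u y)\<^sup>2 \<partial>M) \<partial>M)"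
    by (intro nn_integral_cong nn_integral_eq_integral int) auto
  also have "\<dots> = ennreal (\<integral>x. \<integral>y. (u x - u y)\<^sup>2 \<partial>M \<partial>M)"
    using pair.integrable_fst'[OF 1] by (intro nn_integral_eq_integral) auto
  also have "(\<integral>x. \<integral>y. (u x - u y)\<^sup>2 \<partial>M \<partial>M)
      = 2 * measure M (space M) * (\<integral>x. (u x)\<^sup>2 \<partial>M) - 2 * (\<integral>x. u x \<partial>M)\<^sup>2"
    unfolding eq using u_L2 u_integrable by (simp add: power2_eq_square)
  finally show "(\<integral>\<^sup>+x. \<integral>\<^sup>+y. ennreal ((u x - u y)\<^sup>2) \<partial>M \<partial>M)
    = ennreal (2 * measure M (space M) * (\<integral>x. (u x)\<^sup>2 \<partial>M) - 2 * (\<integral>x. u x \<partial>M)\<^sup>2)" .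
qed

lemma T_measurable: "T u \<in> borel_measurable M"
  unfolding T_def[abs_def] using L_measurable[OF u_measurable u_L2] by measurable

lemma integral_T: "(\<integral>x. T u x \<partial>M) = (\<integral>x. u x \<partial>M)"
  unfolding T_def using u_integrable L_integrable[OF u_measurable u_L2] integral_L[OF u_measurable u_L2]
  by simp

text \<open>In the expansion of the square, the cross term removes half of the energy, while the
  term \<open>(L u x)\<^sup>2 / 4\<close> returns at most a quarter of it.\<close>

lemma T_square_integrable: "integrable M (\<lambda>x. (T u x)\<^sup>2)"
  and T_square_le: "(\<integral>x. (T u x)\<^sup>2 \<partial>M) \<le> (\<integral>x. (u x)\<^sup>2 \<partial>M) - real_energy u / 4"
proof -
  have eq: "(T u x)\<^sup>2 = (u x)\<^sup>2 - u x * L u x + (L u x)\<^sup>2 / 4" for x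
    by (simp add: T_def power2_eq_square field_simps)
  note facts = u_L2 integrable_mult_L[OF u_measurable u_L2] L_square_integrable[OF u_measurable u_L2]
  show "integrable M (\<lambda>x. (T u x)\<^sup>2)"
    unfolding eq using facts by (intro Bochner_Integration.integrable_add
        Bochner_Integration.integrable_diff integrable_divide)
  have "(\<integral>x. (T u x)\<^sup>2 \<partial>M)
      = (\<integral>x. (u x)\<^sup>2 \<partial>M) - real_energy u / 2 + (\<integral>x. (L u x)\<^sup>2 \<partial>M) / 4"
    unfolding eq using facts by (simp add: integral_mult_L[OF u_measurable u_L2])
  then show "(\<integral>x. (T u x)\<^sup>2 \<partial>M) \<le> (\<integral>x. (u x)\<^sup>2 \<partial>M) - real_energy u / 4"
    using L_square_le[OF u_measurable u_L2] by simp
qed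

lemma T_contraction:
  assumes "poincare C" "0 < C" "(\<integral>x. u x \<partial>M) = 0"
  shows "(\<integral>x. (T u x)\<^sup>2 \<partial>M) \<le> (1 - measure M (space M) / (2 * C)) * (\<integral>x. (u x)\<^sup>2 \<partial>M)"
proof -
  have "ennreal (2 * measure M (space M) * (\<integral>x. (u x)\<^sup>2 \<partial>M)) \<le> ennreal C * ennreal (real_energy u)"
    using assms variance_identity energy_eq[OF u_measurable u_L2] u_measurable
    unfolding poincare_def by fastforce
  also have "\<dots> = ennreal (C * real_energy u)"
    using assms(2) real_energy_nonneg[OF u_measurable u_L2] by (simp add: ennreal_mult)
  finally have "2 * measure M (space M) * (\<integral>x. (u x)\<^sup>2 \<partial>M) \<le> C * real_energy u"
    using assms(2) real_energy_nonneg[OF u_measurable u_L2] by simp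
  then have "measure M (space M) / (2 * C) * (\<integral>x. (u x)\<^sup>2 \<partial>M) \<le> real_energy u / 4"
    using assms(2) by (simp add: field_simps)
  then show ?thesis
    using T_square_le unfolding left_diff_distrib by linarith
qed

text \<open>Pairing \<open>L u\<close> with \<open>u\<close> shows that the energy vanishes, and
  \<open>poincare\<close> then forces \<open>u x = u y\<close> for almost all pairs.\<close>

lemma constant_if_L_zero:
  assumes "poincare C" "0 \<le> C" and zero: "AE x in M. L u x = 0"
  shows "\<exists>c. AE x in M. u x = c"
proof (cases "measure M (space M) = 0")
  case True
  then have "AE x in M. False"
    by (simp add: AE_iff_null emeasure_eq_measure null_setsI)
  then show ?thesis by (auto elim: eventually_mono)
next
  case False
  have "(\<integral>x. u x * L u x \<partial>M) = (\<integral>x. 0 \<partial>M)"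
    using zero L_measurable[OF u_measurable u_L2] by (intro integral_cong_AE) auto
  then have "energy u = 0"
    by (simp add: integral_mult_L[OF u_measurable u_L2] energy_eq[OF u_measurable u_L2])
  then have "(\<integral>\<^sup>+x. \<integral>\<^sup>+y. ennreal ((u x - u y)\<^sup>2) \<partial>M \<partial>M) = 0"
    using assms(1) u_measurable unfolding poincare_def by fastforce
  then have "AE x in M. (\<integral>\<^sup>+y. ennreal ((u x - u y)\<^sup>2) \<partial>M) = 0"
    by (subst (asm) nn_integral_0_iff_AE) auto
  \<comment> \<open>Positive measure makes the almost-everywhere filter nontrivial, so an actual
    point \<open>x\<close> can be extracted; \<open>u x\<close> is the constant.\<close>
  moreover have "ae_filter M \<noteq> bot"
    using False by (auto simp: trivial_limit_def AE_iff_null measure_eq_0_null_sets)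
  ultimately obtain x where x: "(\<integral>\<^sup>+y. ennreal ((u x - u y)\<^sup>2) \<partial>M) = 0"
    by (blast dest: eventually_happens')
  have "AE y in M. u y = u x"
    using x by (subst (asm) nn_integral_0_iff_AE) auto
  then show ?thesis ..
qed

end

text \<open>Since \<open>L u = 2 * (u - T u)\<close>, applying \<open>L\<close> to half the sum of
  the iterates of \<open>T\<close> on \<open>g\<close> telescopes to \<open>g\<close>. The mean-zero
  condition persists under \<open>T\<close>, so every step contracts.\<close>

lemma solvable:
  fixes g :: "'a \<Rightarrow> real"
  assumes poincare: "poincare C" "0 < C" and pos: "0 < measure M (space M)"
    and g_measurable [measurable]: "g \<in> borel_measurable M"
    and g_L2: "integrable M (\<lambda>x. (g x)\<^sup>2)" and g_mean: "(\<integral>x. g x \<partial>M) = 0"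
  obtains \<phi> where "\<phi> \<in> borel_measurable M" "integrable M (\<lambda>x. (\<phi> x)\<^sup>2)" "AE x in M. L \<phi> x = g x"
proof -
  define m where "m = measure M (space M)"
  \<comment> \<open>Enlarging the constant to at least \<open>m\<close> gives \<open>q\<close> at
    least 1/2, so its square roots are positive.\<close>
  define C' where "C' = max C m"
  have C': "0 < C'" "m \<le> C'"
    using poincare(2) by (auto simp: C'_def)
  have poincare': "poincare C'"
    unfolding poincare_def
  proof
    fix u :: "'a \<Rightarrow> real" assume "u \<in> borel_measurable M"
    then have "(\<integral>\<^sup>+x. \<integral>\<^sup>+y. ennreal ((u x - u y)\<^sup>2) \<partial>M \<partial>M) \<le> ennreal C * energy u"
      using poincare(1) by (simp add: poincare_def)
    also have "\<dots> \<le> ennreal C' * energy u"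
      by (intro mult_right_mono ennreal_leI) (auto simp: C'_def)
    finally show "(\<integral>\<^sup>+x. \<integral>\<^sup>+y. ennreal ((u x - u y)\<^sup>2) \<partial>M \<partial>M) \<le> ennreal C' * energy u" .
  qed
  define q where "q = 1 - m / (2 * C')"
  have q: "0 < q" "q < 1"
    using pos C' by (auto simp: q_def m_def field_simps)
  \<comment> \<open>The decay \<open>q ^ n\<close> splits into two factors \<open>r ^ n\<close>: one
    absorbs the division by \<open>r ^ n\<close> in \<open>W\<close>, the other makes the series of
    integrals converge. Taking roots of \<open>(u n x)\<^sup>2 \<le> r ^ n * W x\<close> then calls
    for \<open>\<rho>\<close>, the root of \<open>r\<close>.\<close>
  define r where "r = sqrt q"
  define \<rho> where "\<rho> = sqrt r"
  have r: "0 < r" "r < 1" "r * r = q"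
    using q by (auto simp: r_def)
  have \<rho>: "0 < \<rho>" "\<rho> < 1" "\<rho> * \<rho> = r"
    using r by (auto simp: \<rho>_def)
  define u where "u n = (T ^^ n) g" for n
  define G where "G = (\<integral>x. (g x)\<^sup>2 \<partial>M)"
  have u0: "u 0 = g" and uS: "u (Suc n) = T (u n)" for n
    by (simp_all add: u_def)
  have u: "u n \<in> borel_measurable M \<and> integrable M (\<lambda>x. (u n x)\<^sup>2) \<and> (\<integral>x. u n x \<partial>M) = 0
      \<and> (\<integral>x. (u n x)\<^sup>2 \<partial>M) \<le> q ^ n * G" for n
  proof (induction n)
    case 0
    then show ?case
      using g_L2 g_mean by (simp add: u0 G_def)
  next
    case (Suc n)
    then have un: "u n \<in> borel_measurable M" "integrable M (\<lambda>x. (u n x)\<^sup>2)" "(\<integral>x. u n x \<partial>M) = 0"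
      by auto
    have "(\<integral>x. (u (Suc n) x)\<^sup>2 \<partial>M) \<le> q * (\<integral>x. (u n x)\<^sup>2 \<partial>M)"
      using T_contraction[OF un(1,2) poincare' C'(1) un(3)] by (simp add: uS q_def m_def)
    also have "\<dots> \<le> q * (q ^ n * G)"
      using Suc q by (intro mult_left_mono) auto
    finally show ?case
      using T_measurable[OF un(1,2)] T_square_integrable[OF un(1,2)] integral_T[OF un(1,2)] un(3)
      by (simp add: uS mult.assoc)
  qed
  have um [measurable]: "u n \<in> borel_measurable M" and uL2: "integrable M (\<lambda>x. (u n x)\<^sup>2)" for n
    using u by auto
  \<comment> \<open>\<open>\<bar>u n\<bar> \<le> \<rho> ^ n * sqrt W\<close> with \<open>W\<close> integrable dominates the whole series,
    which replaces completeness of \<open>L\<^sup>2\<close>.\<close>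
  define W where "W x = (\<Sum>n. (u n x)\<^sup>2 / r ^ n)" for x
  have W_sum: "summable (\<lambda>n. \<integral>x. (u n x)\<^sup>2 / r ^ n \<partial>M)"
  proof (rule summable_comparison_test')
    show "summable (\<lambda>n. r ^ n * G)"
      using r by (intro summable_mult2 summable_geometric) auto
    show "norm (\<integral>x. (u n x)\<^sup>2 / r ^ n \<partial>M) \<le> r ^ n * G" if "n \<ge> 0" for n
    proof -
      have "0 \<le> (\<integral>x. (u n x)\<^sup>2 \<partial>M)" by simp
      moreover have "(\<integral>x. (u n x)\<^sup>2 \<partial>M) \<le> r ^ n * (r ^ n * G)"
        using u[of n] unfolding r(3)[symmetric] power_mult_distrib by (simp add: mult.assoc)
      ultimately show ?thesis
        using r by (simp add: field_simps)
    qed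
  qed
  have W_int: "integrable M W" and W_AE: "AE x in M. summable (\<lambda>n. (u n x)\<^sup>2 / r ^ n)"
    using AE_summable_integral[OF _ _ W_sum] uL2 r unfolding W_def by auto
  define S where "S x = sqrt (W x)" for x
  have [measurable]: "S \<in> borel_measurable M"
    using W_int unfolding S_def by measurable
  have W_nonneg: "AE x in M. 0 \<le> W x"
    using W_AE by eventually_elim (use r in \<open>auto simp: W_def intro!: suminf_nonneg\<close>)
  have S_L2: "integrable M (\<lambda>x. (S x)\<^sup>2)"
  proof (rule integrable_cong_AE_imp[OF W_int])
    show "AE x in M. W x = (S x)\<^sup>2"
      using W_nonneg by eventually_elim (simp add: S_def)
  qed measurable
  then have S_int: "integrable M S"
    by (rule square_integrable_imp_integrable[rotated]) measurable
  have bound: "AE x in M. \<forall>n. \<bar>u n x\<bar> \<le> \<rho> ^ n * S x"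
    using W_AE
  proof eventually_elim
    case (elim x)
    show ?case
    proof
      fix n
      have "sum (\<lambda>n. (u n x)\<^sup>2 / r ^ n) {n} \<le> W x"
        unfolding W_def using elim r by (intro sum_le_suminf) auto
      then have "(u n x)\<^sup>2 \<le> r ^ n * W x"
        using r by (simp add: field_simps)
      then have "\<bar>u n x\<bar> \<le> sqrt (r ^ n * W x)"
        using real_sqrt_le_mono by fastforce
      also have "\<dots> = \<rho> ^ n * S x"
        by (simp add: real_sqrt_mult real_sqrt_power S_def \<rho>_def)
      finally show "\<bar>u n x\<bar> \<le> \<rho> ^ n * S x" .
    qed
  qed
  have geom: "summable (\<lambda>n. \<rho> ^ n * s)" "(\<Sum>n. \<rho> ^ n * s) = s / (1 - \<rho>)" for s
  proof -
    have "(\<lambda>n. \<rho> ^ n * s) sums (1 / (1 - \<rho>) * s)"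
      using \<rho> by (intro sums_mult2 geometric_sums) auto
    then show "summable (\<lambda>n. \<rho> ^ n * s)" "(\<Sum>n. \<rho> ^ n * s) = s / (1 - \<rho>)"
      by (auto simp: sums_iff)
  qed
  have sum_u: "summable (\<lambda>n. u n x)" "\<bar>\<Sum>n. u n x\<bar> \<le> S x / (1 - \<rho>)"
    if "\<forall>n. \<bar>u n x\<bar> \<le> \<rho> ^ n * S x" for x
  proof -
    have a: "summable (\<lambda>n. \<bar>u n x\<bar>)"
      by (rule summable_comparison_test'[OF geom(1)[of "S x"], of 0]) (use that in auto)
    then show "summable (\<lambda>n. u n x)"
      by (rule summable_rabs_cancel)
    have "\<bar>\<Sum>n. u n x\<bar> \<le> (\<Sum>n. \<bar>u n x\<bar>)"
      by (rule summable_rabs[OF a])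
    also have "\<dots> \<le> (\<Sum>n. \<rho> ^ n * S x)"
      using that a geom by (intro suminf_le) auto
    finally show "\<bar>\<Sum>n. u n x\<bar> \<le> S x / (1 - \<rho>)"
      by (simp add: geom)
  qed
  define \<phi> where "\<phi> x = (\<Sum>n. u n x) / 2" for x
  have \<phi>_meas [measurable]: "\<phi> \<in> borel_measurable M"
    unfolding \<phi>_def by measurable
  have \<phi>_L2: "integrable M (\<lambda>x. (\<phi> x)\<^sup>2)"
  proof (rule Bochner_Integration.integrable_bound)
    show "integrable M (\<lambda>x. (S x)\<^sup>2 / (1 - \<rho>)\<^sup>2)"
      using S_L2 by simp
    show "AE x in M. norm ((\<phi> x)\<^sup>2) \<le> norm ((S x)\<^sup>2 / (1 - \<rho>)\<^sup>2)"
      using bound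
    proof eventually_elim
      case (elim x)
      have "\<bar>\<phi> x\<bar> \<le> \<bar>\<Sum>n. u n x\<bar>"
        by (simp add: \<phi>_def)
      also note sum_u(2)[OF elim]
      finally have "\<bar>\<phi> x\<bar>\<^sup>2 \<le> (S x / (1 - \<rho>))\<^sup>2"
        by (intro power_mono) auto
      then show ?case
        by (simp add: power_divide)
    qed
  qed measurable
  \<comment> \<open>Countably many null sets are merged, so a single exceptional set of
    \<open>x\<close> serves all \<open>n\<close>.\<close>
  have "AE x in M. \<forall>n. integrable M (\<lambda>y. k x y * (u n x - u n y))"
    using pair.AE_integrable_fst'[OF integrable_kernel_diff[OF um uL2]] by (simp add: AE_all_countable)
  moreover have "AE x in M. integrable M (\<lambda>y. k x y * S y)"
    using pair.AE_integrable_fst'[OF integrable_weight(2)[OF _ S_int]] by simp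
  ultimately have "AE x in M. L \<phi> x = g x"
    using bound AE_space
  proof eventually_elim
    case (elim x)
    define f where "f n y = k x y * (u n x - u n y) / 2" for n y
    have f_int: "integrable M (f n)" for n
      using elim(1) unfolding f_def by simp
    have f_le: "AE y in M. \<forall>n. \<bar>f n y\<bar> \<le> \<rho> ^ n * (k x y * (S x + S y))"
      using bound
    proof eventually_elim
      case (elim y)
      show ?case
      proof
        fix n
        have "\<bar>u n x - u n y\<bar> \<le> \<rho> ^ n * (S x + S y)"
          using \<open>\<forall>n. \<bar>u n x\<bar> \<le> \<rho> ^ n * S x\<close>[rule_format, of n] elim[rule_format, of n]
            abs_triangle_ineq4[of "u n x" "u n y"] by (simp add: distrib_left)
        then have "k x y * \<bar>u n x - u n y\<bar> \<le> k x y * (\<rho> ^ n * (S x + S y))"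
          by (rule mult_left_mono) (rule k_nonneg)
        moreover have "\<bar>f n y\<bar> \<le> k x y * \<bar>u n x - u n y\<bar>"
          using k_nonneg[of x y] by (simp add: f_def abs_mult)
        ultimately show "\<bar>f n y\<bar> \<le> \<rho> ^ n * (k x y * (S x + S y))"
          by (simp add: mult_ac)
      qed
    qed
    \<comment> \<open>For fixed \<open>x\<close>, this multiple of the kernel dominates all terms up
      to the geometric factor, which justifies exchanging sum and integral.\<close>
    have dom: "integrable M (\<lambda>y. k x y * (S x + S y))"
      using k_integrable(1)[OF elim(4)] elim(2) by (simp add: distrib_left)
    have f_AE: "AE y in M. summable (\<lambda>n. norm (f n y))"
      using f_le
    proof eventually_elim
      case (elim y)
      show ?case
        by (rule summable_comparison_test'[OF geom(1)[of "k x y * (S x + S y)"], of 0])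
          (use elim in auto)
    qed
    have f_sum: "summable (\<lambda>n. \<integral>y. norm (f n y) \<partial>M)"
    proof (rule summable_comparison_test'[OF geom(1)[of "\<integral>y. k x y * (S x + S y) \<partial>M"], of 0])
      fix n :: nat
      have "(\<integral>y. norm (f n y) \<partial>M) \<le> (\<integral>y. \<rho> ^ n * (k x y * (S x + S y)) \<partial>M)"
        using f_int dom f_le by (intro integral_mono_AE) (auto elim!: eventually_mono)
      then show "norm (\<integral>y. norm (f n y) \<partial>M) \<le> \<rho> ^ n * (\<integral>y. k x y * (S x + S y) \<partial>M)"
        by simp
    qed
    have int_f: "integral\<^sup>L M (f n) = L (u n) x / 2" for n
      unfolding f_def L_def by simp
    have sx: "summable (\<lambda>n. u n x)"
      by (rule sum_u(1)[OF elim(3)])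
    have "L \<phi> x = (\<integral>y. (\<Sum>n. f n y) \<partial>M)"
      unfolding L_def
    proof (rule integral_cong_AE)
      have [measurable]: "k x \<in> borel_measurable M"
        using elim(4) by measurable
      show "(\<lambda>y. k x y * (\<phi> x - \<phi> y)) \<in> borel_measurable M"
        by measurable
      show "(\<lambda>y. \<Sum>n. f n y) \<in> borel_measurable M"
        unfolding f_def by measurable
      show "AE y in M. k x y * (\<phi> x - \<phi> y) = (\<Sum>n. f n y)"
        using bound
      proof eventually_elim
        case (elim y)
        have "(\<lambda>n. k x y * (u n x - u n y) / 2) sums (k x y * ((\<Sum>n. u n x) - (\<Sum>n. u n y)) / 2)"
          using sx sum_u(1)[OF elim]
          by (intro sums_divide sums_mult sums_diff summable_sums)
        then show ?case
          by (simp add: f_def \<phi>_def sums_iff diff_divide_distrib[symmetric])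
      qed
    qed
    also have "\<dots> = (\<Sum>n. integral\<^sup>L M (f n))"
      by (rule integral_suminf[OF f_int f_AE f_sum])
    \<comment> \<open>Half of \<open>L (u n) x\<close> is \<open>u n x - T (u n) x\<close>. The
      telescoping sum loses nothing at infinity because the terms of a convergent series tend to
      0.\<close>
    also have "\<dots> = (\<Sum>n. u n x - u (Suc n) x)"
      by (simp add: int_f uS T_def)
    also have "\<dots> = u 0 x"
      using telescope_sums'[OF summable_LIMSEQ_zero[OF sx]] by (simp add: sums_iff)
    finally show "L \<phi> x = g x"
      by (simp add: u0)
  qed
  with \<phi>_meas \<phi>_L2 show thesis
    by (rule that)
qed

text \<open>Linearity of the integral is applied where both integrands are integrable in
  \<open>y\<close>, which is known for almost every \<open>x\<close>; hence the almost-everywhere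
  form.\<close>

lemma L_diff:
  assumes u: "u \<in> borel_measurable M" "integrable M (\<lambda>x. (u x)\<^sup>2)"
    and v: "v \<in> borel_measurable M" "integrable M (\<lambda>x. (v x)\<^sup>2)"
  shows "AE x in M. L (\<lambda>x. u x - v x) x = L u x - L v x"
  using pair.AE_integrable_fst'[OF integrable_kernel_diff[OF u]] pair.AE_integrable_fst'[OF integrable_kernel_diff[OF v]]
proof eventually_elim
  case (elim x)
  have "L (\<lambda>x. u x - v x) x = (\<integral>y. k x y * (u x - u y) - k x y * (v x - v y) \<partial>M)"
    unfolding L_def by (simp add: algebra_simps)
  with elim show ?case
    by (simp add: L_def)
qed

section \<open>Propagation of the Poincare inequality\<close>

definition energy_on :: "('a \<Rightarrow> 'a \<Rightarrow> bool) \<Rightarrow> ('a \<Rightarrow> real) \<Rightarrow> ennreal" where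
  "energy_on R u = (\<integral>\<^sup>+x. \<integral>\<^sup>+y. (if R x y then ennreal ((u x - u y)\<^sup>2) else 0) \<partial>M \<partial>M)"

text \<open>A Poincare inequality restricted to the pairs related by \<open>R\<close>, with a
  constant uniform in \<open>u\<close>. Working with relations lets pairs be chained through
  intermediate points.\<close>

definition controlled :: "('a \<Rightarrow> 'a \<Rightarrow> bool) \<Rightarrow> bool" where
  "controlled R \<longleftrightarrow> Measurable.pred (M \<Otimes>\<^sub>M M) (\<lambda>p. R (fst p) (snd p)) \<and>
     (\<exists>C::real. 0 \<le> C \<and> (\<forall>u\<in>borel_measurable M. energy_on R u \<le> ennreal C * energy u))"

lemma pred_compose2:
  assumes "Measurable.pred (M \<Otimes>\<^sub>M M) (\<lambda>p. R (fst p) (snd p))"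
    "f \<in> measurable N M" "g \<in> measurable N M"
  shows "Measurable.pred N (\<lambda>x. R (f x) (g x))"
  using measurable_compose[OF measurable_Pair[OF assms(2,3)] assms(1)] unfolding fst_conv snd_conv .

lemma controlled_mono:
  assumes "controlled S" and R: "Measurable.pred (M \<Otimes>\<^sub>M M) (\<lambda>p. R (fst p) (snd p))"
    and le: "\<And>x y. x \<in> space M \<Longrightarrow> y \<in> space M \<Longrightarrow> R x y \<Longrightarrow> S x y"
  shows "controlled R"
proof -
  obtain C where C: "0 \<le> C" "\<And>u. u \<in> borel_measurable M \<Longrightarrow> energy_on S u \<le> ennreal C * energy u"
    using assms(1) by (auto simp: controlled_def)
  have "energy_on R u \<le> energy_on S u" for u
    unfolding energy_on_def using le by (intro nn_integral_mono) auto
  then show ?thesis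
    unfolding controlled_def using R C by (blast intro: order_trans)
qed

lemma controlled_disj:
  assumes "controlled R" "controlled S"
  shows "controlled (\<lambda>x y. R x y \<or> S x y)"
proof -
  obtain A where A: "0 \<le> A" "\<And>u. u \<in> borel_measurable M \<Longrightarrow> energy_on R u \<le> ennreal A * energy u"
    and "Measurable.pred (M \<Otimes>\<^sub>M M) (\<lambda>p. R (fst p) (snd p))"
    using assms(1) by (auto simp: controlled_def)
  note [measurable] = pred_compose2[OF this(3)]
  obtain B where B: "0 \<le> B" "\<And>u. u \<in> borel_measurable M \<Longrightarrow> energy_on S u \<le> ennreal B * energy u"
    and "Measurable.pred (M \<Otimes>\<^sub>M M) (\<lambda>p. S (fst p) (snd p))"
    using assms(2) by (auto simp: controlled_def)
  note [measurable] = pred_compose2[OF this(3)]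
  have "energy_on (\<lambda>x y. R x y \<or> S x y) u \<le> ennreal (A + B) * energy u"
    if [measurable]: "u \<in> borel_measurable M" for u
  proof -
    have "energy_on (\<lambda>x y. R x y \<or> S x y) u
        \<le> (\<integral>\<^sup>+x. \<integral>\<^sup>+y. (if R x y then ennreal ((u x - u y)\<^sup>2) else 0)
            + (if S x y then ennreal ((u x - u y)\<^sup>2) else 0) \<partial>M \<partial>M)"
      unfolding energy_on_def by (intro nn_integral_mono) auto
    also have "\<dots> = (\<integral>\<^sup>+x. (\<integral>\<^sup>+y. (if R x y then ennreal ((u x - u y)\<^sup>2) else 0) \<partial>M)
            + (\<integral>\<^sup>+y. (if S x y then ennreal ((u x - u y)\<^sup>2) else 0) \<partial>M) \<partial>M)"
      by (intro nn_integral_cong nn_integral_add) measurable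
    also have "\<dots> = energy_on R u + energy_on S u"
      unfolding energy_on_def by (intro nn_integral_add) measurable
    also have "\<dots> \<le> ennreal A * energy u + ennreal B * energy u"
      using A B that by (intro add_mono) auto
    finally show ?thesis
      using A B by (simp add: distrib_right)
  qed
  then show ?thesis
    unfolding controlled_def using A(1) B(1) by (intro conjI exI[of _ "A + B"]) auto
qed

text \<open>On these pairs 1 is at most \<open>k x y / \<epsilon>\<close>.\<close>

lemma controlled_superlevel:
  assumes "0 < \<epsilon>"
  shows "controlled (\<lambda>x y. \<epsilon> \<le> k x y)"
proof -
  have "energy_on (\<lambda>x y. \<epsilon> \<le> k x y) u \<le> ennreal (1 / \<epsilon>) * energy u"
    if [measurable]: "u \<in> borel_measurable M" for u
  proof -
    have "energy_on (\<lambda>x y. \<epsilon> \<le> k x y) u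
        \<le> (\<integral>\<^sup>+x. \<integral>\<^sup>+y. ennreal (1 / \<epsilon>) * ennreal (k x y * (u x - u y)\<^sup>2) \<partial>M \<partial>M)"
      unfolding energy_on_def
    proof (intro nn_integral_mono)
      fix x y
      show "(if \<epsilon> \<le> k x y then ennreal ((u x - u y)\<^sup>2) else 0)
          \<le> ennreal (1 / \<epsilon>) * ennreal (k x y * (u x - u y)\<^sup>2)"
      proof (cases "\<epsilon> \<le> k x y")
        case True
        then have "\<epsilon> * (u x - u y)\<^sup>2 \<le> k x y * (u x - u y)\<^sup>2"
          by (rule mult_right_mono) simp
        with True assms show ?thesis
          by (simp add: ennreal_mult[symmetric] field_simps)
      qed simp
    qed
    also have "\<dots> = (\<integral>\<^sup>+x. ennreal (1 / \<epsilon>) * (\<integral>\<^sup>+y. ennreal (k x y * (u x - u y)\<^sup>2) \<partial>M) \<partial>M)"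
      by (intro nn_integral_cong nn_integral_cmult) measurable
    also have "\<dots> = ennreal (1 / \<epsilon>) * energy u"
      unfolding energy_def by (intro nn_integral_cmult) measurable
    finally show ?thesis .
  qed
  then show ?thesis
    unfolding controlled_def using assms by (intro conjI exI[of _ "1 / \<epsilon>"]) auto
qed

text \<open>The chaining step: \<open>(u x - u y)\<^sup>2\<close> is at most twice the sum of the
  squared differences through \<open>z\<close>. Averaging over admissible \<open>z\<close>, which
  fill measure at least \<open>m\<close>, and integrating over \<open>x\<close> and \<open>y\<close>
  leaves only the two controlled energies.\<close>

lemma controlled_comp:
  assumes "controlled R1" "controlled R2"
    and S: "Measurable.pred (M \<Otimes>\<^sub>M M) (\<lambda>p. S (fst p) (snd p))"
    and m: "0 < m" "\<And>x y. x \<in> space M \<Longrightarrow> y \<in> space M \<Longrightarrow> S x y \<Longrightarrow>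
      ennreal m \<le> emeasure M {z\<in>space M. R1 x z \<and> R2 z y}"
  shows "controlled S"
proof -
  obtain A where A: "0 \<le> A" "\<And>u. u \<in> borel_measurable M \<Longrightarrow> energy_on R1 u \<le> ennreal A * energy u"
    and "Measurable.pred (M \<Otimes>\<^sub>M M) (\<lambda>p. R1 (fst p) (snd p))"
    using assms(1) by (auto simp: controlled_def)
  note [measurable] = pred_compose2[OF this(3)]
  obtain B where B: "0 \<le> B" "\<And>u. u \<in> borel_measurable M \<Longrightarrow> energy_on R2 u \<le> ennreal B * energy u"
    and "Measurable.pred (M \<Otimes>\<^sub>M M) (\<lambda>p. R2 (fst p) (snd p))"
    using assms(2) by (auto simp: controlled_def)
  note [measurable] = pred_compose2[OF this(3)] pred_compose2[OF S]
  define V where "V = measure M (space M)"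
  have V: "0 \<le> V" "emeasure M (space M) = ennreal V"
    by (auto simp: V_def emeasure_eq_measure)
  \<comment> \<open>The factor \<open>V\<close> comes from integrating out the variable missing from
    each term, the 2 from splitting the square, and the division by \<open>m\<close> from averaging
    over \<open>z\<close>.\<close>
  define K where "K = V * (2 * A + 2 * B) / m"
  have K: "0 \<le> K"
    using A(1) B(1) V(1) m(1) by (simp add: K_def)
  have "energy_on S u \<le> ennreal K * energy u"
    if [measurable]: "u \<in> borel_measurable M" for u
  proof -
    let ?D = "\<lambda>x y. ennreal ((u x - u y)\<^sup>2)"
    let ?a = "\<lambda>x z. if R1 x z then ?D x z else 0" and ?b = "\<lambda>z y. if R2 z y then ?D z y else 0"
    have D: "?D x y \<le> 2 * ?D x z + 2 * ?D z y" for x y z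
    proof -
      have "(u x - u y)\<^sup>2 \<le> 2 * (u x - u z)\<^sup>2 + 2 * (u z - u y)\<^sup>2"
        using zero_le_power2[of "u x - 2 * u z + u y"] by (simp add: power2_eq_square algebra_simps)
      then have "?D x y \<le> ennreal (2 * (u x - u z)\<^sup>2 + 2 * (u z - u y)\<^sup>2)"
        by (rule ennreal_leI)
      then show ?thesis by (simp add: ennreal_mult)
    qed
    have "ennreal m * (if S x y then ?D x y else 0) \<le> (\<integral>\<^sup>+z. 2 * ?a x z + 2 * ?b z y \<partial>M)"
      if [measurable]: "x \<in> space M" "y \<in> space M" for x y
    proof (cases "S x y")
      case True
      let ?Z = "{z\<in>space M. R1 x z \<and> R2 z y}"
      have [measurable]: "?Z \<in> sets M" by measurable
      have "ennreal m * ?D x y \<le> emeasure M ?Z * ?D x y"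
        using m(2)[OF that True] by (rule mult_right_mono) simp
      also have "\<dots> = (\<integral>\<^sup>+z. ?D x y * indicator ?Z z \<partial>M)"
        by (subst nn_integral_cmult_indicator) (auto simp: mult.commute)
      also have "\<dots> \<le> (\<integral>\<^sup>+z. 2 * ?a x z + 2 * ?b z y \<partial>M)"
        using D by (intro nn_integral_mono) (auto split: split_indicator)
      finally show ?thesis using True by simp
    qed simp
    then have "(\<integral>\<^sup>+x. \<integral>\<^sup>+y. ennreal m * (if S x y then ?D x y else 0) \<partial>M \<partial>M)
        \<le> (\<integral>\<^sup>+x. \<integral>\<^sup>+y. \<integral>\<^sup>+z. 2 * ?a x z + 2 * ?b z y \<partial>M \<partial>M \<partial>M)"
      by (intro nn_integral_mono) auto
    also have "(\<integral>\<^sup>+x. \<integral>\<^sup>+y. ennreal m * (if S x y then ?D x y else 0) \<partial>M \<partial>M)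
        = (\<integral>\<^sup>+x. ennreal m * (\<integral>\<^sup>+y. (if S x y then ?D x y else 0) \<partial>M) \<partial>M)"
      by (intro nn_integral_cong nn_integral_cmult) measurable
    also have "\<dots> = ennreal m * energy_on S u"
      unfolding energy_on_def by (intro nn_integral_cmult) measurable
    also have "(\<integral>\<^sup>+x. \<integral>\<^sup>+y. \<integral>\<^sup>+z. 2 * ?a x z + 2 * ?b z y \<partial>M \<partial>M \<partial>M)
        = (\<integral>\<^sup>+x. \<integral>\<^sup>+y. 2 * (\<integral>\<^sup>+z. ?a x z \<partial>M) + 2 * (\<integral>\<^sup>+z. ?b z y \<partial>M) \<partial>M \<partial>M)"
      by (intro nn_integral_cong, subst nn_integral_add) (auto simp: nn_integral_cmult)
    also have "\<dots> = (\<integral>\<^sup>+x. V * (2 * (\<integral>\<^sup>+z. ?a x z \<partial>M)) + 2 * (\<integral>\<^sup>+y. \<integral>\<^sup>+z. ?b z y \<partial>M \<partial>M) \<partial>M)"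
      by (intro nn_integral_cong, subst nn_integral_add)
         (auto simp: nn_integral_cmult V mult.commute)
    also have "\<dots> = V * (2 * energy_on R1 u) + V * (2 * (\<integral>\<^sup>+y. \<integral>\<^sup>+z. ?b z y \<partial>M \<partial>M))"
      by (subst nn_integral_add) (auto simp: nn_integral_cmult energy_on_def V mult.commute)
    also have "(\<integral>\<^sup>+y. \<integral>\<^sup>+z. ?b z y \<partial>M \<partial>M) = energy_on R2 u"
      unfolding energy_on_def by (rule pair.Fubini') measurable
    also have "V * (2 * energy_on R1 u) + V * (2 * energy_on R2 u)
        \<le> V * (2 * (ennreal A * energy u)) + V * (2 * (ennreal B * energy u))"
      using A(2)[OF that] B(2)[OF that] by (intro add_mono mult_left_mono) auto
    also have "\<dots> = ennreal (m * K) * energy u"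
    proof -
      have "m * K = V * (2 * A) + V * (2 * B)"
        using m(1) by (simp add: K_def field_simps)
      then have "ennreal (m * K) = ennreal V * (2 * ennreal A) + ennreal V * (2 * ennreal B)"
        using A(1) B(1) V(1) by (simp add: ennreal_mult)
      then show ?thesis
        by (simp add: distrib_right mult.assoc)
    qed
    finally have "ennreal m * energy_on S u \<le> ennreal m * (ennreal K * energy u)"
      using m(1) K by (simp add: ennreal_mult mult.assoc)
    then have "ennreal (1/m) * (ennreal m * energy_on S u)
        \<le> ennreal (1/m) * (ennreal m * (ennreal K * energy u))"
      by (rule mult_left_mono) simp
    then show ?thesis
      using m(1) by (simp add: mult.assoc[symmetric] ennreal_mult[symmetric])
  qed
  then show ?thesis
    unfolding controlled_def using S K by blast
qed

definition controlled_on :: "'a set \<Rightarrow> bool" where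
  "controlled_on E \<longleftrightarrow> E \<in> sets M \<and> controlled (\<lambda>x y. x \<in> E \<and> y \<in> E)"

text \<open>Pairs inside one set are controlled already; a mixed pair is chained through the points
  of the intersection, whose measure serves as \<open>m\<close> in
  \<open>controlled_comp\<close>.\<close>

lemma controlled_on_Un:
  assumes "controlled_on E" "controlled_on F" "0 < emeasure M (E \<inter> F)"
  shows "controlled_on (E \<union> F)"
proof -
  have [measurable]: "E \<in> sets M" "F \<in> sets M"
    and E: "controlled (\<lambda>x y. x \<in> E \<and> y \<in> E)" and F: "controlled (\<lambda>x y. x \<in> F \<and> y \<in> F)"
    using assms by (auto simp: controlled_on_def)
  have sub: "E \<subseteq> space M" "F \<subseteq> space M"
    by (simp_all add: sets.sets_into_space)
  define m where "m = measure M (E \<inter> F)"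
  have m: "0 < m" "ennreal m = emeasure M (E \<inter> F)"
    using assms(3) by (auto simp: m_def emeasure_eq_measure)
  have EF: "controlled (\<lambda>x y. x \<in> E \<and> y \<in> F)"
  proof (rule controlled_comp[OF E F _ m(1)])
    show "ennreal m \<le> emeasure M {z \<in> space M. (x \<in> E \<and> z \<in> E) \<and> z \<in> F \<and> y \<in> F}"
      if "x \<in> E \<and> y \<in> F" for x y
      unfolding m using that sub by (intro emeasure_mono) auto
  qed measurable
  have FE: "controlled (\<lambda>x y. x \<in> F \<and> y \<in> E)"
  proof (rule controlled_comp[OF F E _ m(1)])
    show "ennreal m \<le> emeasure M {z \<in> space M. (x \<in> F \<and> z \<in> F) \<and> z \<in> E \<and> y \<in> E}"
      if "x \<in> F \<and> y \<in> E" for x y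
      unfolding m using that sub by (intro emeasure_mono) auto
  qed measurable
  have "controlled (\<lambda>x y. x \<in> E \<union> F \<and> y \<in> E \<union> F)"
    by (rule controlled_mono[OF controlled_disj[OF controlled_disj[OF E F] controlled_disj[OF EF FE]]])
      auto
  then show ?thesis
    by (simp add: controlled_on_def)
qed

lemma poincare_if_controlled_on_space:
  assumes "controlled_on (space M)"
  obtains C where "0 < C" "poincare C"
proof -
  obtain C where C: "0 \<le> C" "\<And>u. u \<in> borel_measurable M \<Longrightarrow>
      energy_on (\<lambda>x y. x \<in> space M \<and> y \<in> space M) u \<le> ennreal C * energy u"
    using assms by (auto simp: controlled_on_def controlled_def)
  \<comment> \<open>The added 1 turns a nonnegative constant into a positive one.\<close>
  have "poincare (C + 1)"
    unfolding poincare_def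
  proof
    fix u :: "'a \<Rightarrow> real" assume u: "u \<in> borel_measurable M"
    have "(\<integral>\<^sup>+x. \<integral>\<^sup>+y. ennreal ((u x - u y)\<^sup>2) \<partial>M \<partial>M)
        = energy_on (\<lambda>x y. x \<in> space M \<and> y \<in> space M) u"
      unfolding energy_on_def by (intro nn_integral_cong) auto
    also have "\<dots> \<le> ennreal C * energy u"
      by (rule C(2)[OF u])
    also have "\<dots> \<le> ennreal (C + 1) * energy u"
      by (intro mult_right_mono ennreal_leI) auto
    finally show "(\<integral>\<^sup>+x. \<integral>\<^sup>+y. ennreal ((u x - u y)\<^sup>2) \<partial>M \<partial>M) \<le> ennreal (C + 1) * energy u" .
  qed
  then show thesis
    using C(1) by (intro that[of "C + 1"]) auto
qed

end

section \<open>Convolution kernels on a bounded domain\<close>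

locale nonlocal_domain =
  fixes J :: "'a::euclidean_space \<Rightarrow> real" and d :: real and \<Omega> :: "'a set"
  assumes \<Omega>_bounded: "bounded \<Omega>" and \<Omega>_open: "open \<Omega>" and \<Omega>_connected: "connected \<Omega>"
    and \<Omega>_nonempty: "\<Omega> \<noteq> {}"
    and J_measurable [measurable]: "J \<in> borel_measurable borel"
    and J_nonneg: "\<And>x. 0 \<le> J x" and J_sym: "\<And>x. J (- x) = J x"
    and J_integrable: "integrable lborel J" and J_mass: "(\<integral>x. J x \<partial>lborel) = 1"
    and d_pos: "0 < d" and J_pos: "\<And>x. norm x < d \<Longrightarrow> 0 < J x"
begin

abbreviation M where "M \<equiv> restrict_space lborel \<Omega>"

lemma \<Omega>_sets: "\<Omega> \<in> sets borel"
  using \<Omega>_open by simp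

lemma J_flip: "J (x - y) = J (y - x)"
  using J_sym[of "x - y"] by simp

lemma id_measurable [measurable]: "(\<lambda>x. x) \<in> measurable M borel"
  by (rule measurable_restrict_space1) simp

sublocale symmetric_kernel M "\<lambda>x y. J (x - y)"
proof (intro symmetric_kernel.intro finite_measureI symmetric_kernel_axioms.intro)
  show "emeasure M (space M) \<noteq> \<infinity>"
    using emeasure_bounded_finite[OF \<Omega>_bounded] \<Omega>_sets
    by (simp add: space_restrict_space emeasure_restrict_space)
  have [measurable]: "fst \<in> borel_measurable (M \<Otimes>\<^sub>M M)" "snd \<in> borel_measurable (M \<Otimes>\<^sub>M M)"
    using measurable_compose[OF measurable_fst id_measurable] measurable_compose[OF measurable_snd id_measurable]
    by simp_all
  show "(\<lambda>p. J (fst p - snd p)) \<in> borel_measurable (M \<Otimes>\<^sub>M M)"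
    by measurable
  show "0 \<le> J (x - y)" for x y
    by (rule J_nonneg)
  show "J (x - y) = J (y - x)" for x y
    by (rule J_flip)
  show "(\<integral>\<^sup>+y. ennreal (J (x - y)) \<partial>M) \<le> 1" for x
  proof -
    have "(\<integral>\<^sup>+y. ennreal (J (x - y)) \<partial>M) = (\<integral>\<^sup>+y. ennreal (J (x - y)) * indicator \<Omega> y \<partial>lborel)"
      using \<Omega>_sets by (simp add: nn_integral_restrict_space)
    \<comment> \<open>Dropping the restriction to \<open>\<Omega>\<close> only enlarges the
      integral, and symmetry puts the argument into the form required for translation.\<close>
    also have "\<dots> \<le> (\<integral>\<^sup>+y. ennreal (J (- x + y)) \<partial>lborel)"
      by (intro nn_integral_mono) (auto simp: J_flip[of x] split: split_indicator)
    also have "\<dots> = (\<integral>\<^sup>+y. ennreal (J y) \<partial>lborel)"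
      by (rule nn_integral_lborel_translate[of "\<lambda>y. ennreal (J y)"]) measurable
    also have "\<dots> = 1"
      using J_integrable J_nonneg J_mass by (simp add: nn_integral_eq_integral)
    finally show ?thesis .
  qed
qed

text \<open>Continuity of measure from above: the sublevel sets for 1/(n+1) decrease, have finite
  measure, and have empty intersection because \<open>J\<close> is positive on the ball.\<close>

lemma small_sublevel:
  assumes "0 < m"
  obtains \<epsilon> where "0 < \<epsilon>" "emeasure lborel {w\<in>ball 0 d. J w < \<epsilon>} < ennreal m"
proof -
  define N where "N n = {w\<in>ball 0 d. J w < 1 / (real n + 1)}" for n
  have [measurable]: "N n \<in> sets borel" for n
    unfolding N_def by measurable
  have "bounded (N n)" for n
    by (rule bounded_subset[of "ball 0 d"]) (auto simp: N_def)
  then have fin: "emeasure lborel (N n) \<noteq> \<infinity>" for n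
    by (metis emeasure_bounded_finite less_irrefl)
  have dec: "decseq N"
  proof (rule decseq_SucI, rule subsetI)
    fix n w assume "w \<in> N (Suc n)"
    moreover have "1 / (real (Suc n) + 1) \<le> 1 / (real n + 1)"
      by (simp add: field_simps)
    ultimately show "w \<in> N n"
      by (auto simp: N_def simp del: of_nat_Suc)
  qed
  have empty: "(\<Inter>n. N n) = {}"
  proof (rule ccontr)
    assume "(\<Inter>n. N n) \<noteq> {}"
    then obtain w where w: "\<And>n. w \<in> N n" by blast
    then have "0 < J w"
      using J_pos[of w] by (auto simp: N_def)
    then obtain n where "1 / (real n + 1) < J w"
      using nat_approx_posE[of "J w"] by (metis of_nat_Suc add.commute)
    with w[of n] show False by (simp add: N_def)
  qed
  have "(\<lambda>n. emeasure lborel (N n)) \<longlonglongrightarrow> emeasure lborel (\<Inter>n. N n)"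
    using dec fin by (intro Lim_emeasure_decseq) auto
  then have "(\<lambda>n. emeasure lborel (N n)) \<longlonglongrightarrow> 0"
    by (simp add: empty)
  then have "\<forall>\<^sub>F n in sequentially. emeasure lborel (N n) < ennreal m"
    using assms by (intro order_tendstoD(2)) auto
  then obtain n where "emeasure lborel (N n) < ennreal m"
    by (auto simp: eventually_sequentially)
  then show thesis
    by (intro that[of "1 / (real n + 1)"]) (auto simp: N_def)
qed

lemma sets_M: "E \<in> sets borel \<Longrightarrow> E \<subseteq> \<Omega> \<Longrightarrow> E \<in> sets M"
  and emeasure_M: "E \<subseteq> \<Omega> \<Longrightarrow> emeasure M E = emeasure lborel E"
  using \<Omega>_sets by (auto simp: sets_restrict_space_iff emeasure_restrict_space)

lemma space_M [simp]: "space M = \<Omega>"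
  by (simp add: space_restrict_space)

text \<open>\<open>J\<close> need not be bounded below near any point, but for two points of a set of diameter less
  than \<open>d\<close> the intermediate points with \<open>J \<ge> \<epsilon>\<close> towards both have measure bounded below.\<close>

lemma controlled_on_ball: "controlled_on (\<Omega> \<inter> ball p (d / 2))"
proof (cases "\<Omega> \<inter> ball p (d / 2) = {}")
  case True
  have "controlled (\<lambda>x y. False)"
    by (rule controlled_mono[OF controlled_superlevel[of 1]]) auto
  then show ?thesis
    unfolding controlled_on_def True by simp
next
  case False
  define E where "E = \<Omega> \<inter> ball p (d / 2)"
  have E_open: "open E" and E_sub: "E \<subseteq> \<Omega>"
    using \<Omega>_open by (auto simp: E_def)
  have E_borel: "E \<in> sets borel"
    using E_open by simp
  have E_sets [measurable]: "E \<in> sets M"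
    by (rule sets_M[OF E_borel E_sub])
  have E_eq: "emeasure lborel E = ennreal (measure M E)"
    using emeasure_M[OF E_sub] by (simp add: emeasure_eq_measure)
  \<comment> \<open>For each of the two points, the bad intermediate points in \<open>E\<close> have
    measure at most \<open>m\<close>; removing both bad sets leaves at least a third of
    \<open>E\<close>.\<close>
  define m where "m = measure M E / 3"
  have m: "0 < m"
    using emeasure_lborel_open_pos[OF E_open] False by (simp add: m_def E_def[symmetric] E_eq)
  obtain \<epsilon> where \<epsilon>: "0 < \<epsilon>" "emeasure lborel {w\<in>ball 0 d. J w < \<epsilon>} < ennreal m"
    using small_sublevel[OF m] .
  define N where "N = {w\<in>ball 0 d. J w < \<epsilon>}"
  have N: "N \<in> sets borel"
    unfolding N_def by measurable
  have "controlled (\<lambda>x y. x \<in> E \<and> y \<in> E)"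
  proof (rule controlled_comp[OF controlled_superlevel[OF \<epsilon>(1)] controlled_superlevel[OF \<epsilon>(1)] _ m])
    fix x y assume xy: "x \<in> space M" "y \<in> space M" "x \<in> E \<and> y \<in> E"
    define Z where "Z = {z \<in> space M. \<epsilon> \<le> J (x - z) \<and> \<epsilon> \<le> J (z - y)}"
    have Z: "Z \<in> sets M"
      unfolding Z_def using xy by measurable
    \<comment> \<open>Differences of points of \<open>E\<close> stay where \<open>J\<close> is
      positive, so a value of \<open>J\<close> below \<open>\<epsilon>\<close> at such a difference
      places it in \<open>N\<close>.\<close>
    have near: "z - w \<in> ball 0 d" if "z \<in> E" "w \<in> E" for z w
    proof -
      have "norm (z - w) \<le> dist p z + dist p w"
        by (metis dist_commute dist_norm dist_triangle)
      then show ?thesis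
        using that by (auto simp: E_def)
    qed
    have sub: "E \<subseteq> Z \<union> ((E \<inter> {z. z - x \<in> N}) \<union> (E \<inter> {z. z - y \<in> N}))"
    proof
      fix z assume z: "z \<in> E"
      show "z \<in> Z \<union> ((E \<inter> {z. z - x \<in> N}) \<union> (E \<inter> {z. z - y \<in> N}))"
        using z xy near[of z x] near[of z y] E_sub J_flip[of x z]
        by (auto simp: Z_def N_def not_less)
    qed
    have small: "E \<inter> {z. z - v \<in> N} \<in> sets M" "measure M (E \<inter> {z. z - v \<in> N}) \<le> m" for v
    proof -
      show s: "E \<inter> {z. z - v \<in> N} \<in> sets M"
        using E_borel E_sub emeasure_lborel_translate(1)[OF N] by (intro sets_M) auto
      have "emeasure M (E \<inter> {z. z - v \<in> N}) = emeasure lborel (E \<inter> {z. z - v \<in> N})"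
        using E_sub by (intro emeasure_M) auto
      also have "\<dots> \<le> emeasure lborel {z. z - v \<in> N}"
        using emeasure_lborel_translate(1)[OF N] by (intro emeasure_mono) auto
      also have "\<dots> \<le> ennreal m"
        using emeasure_lborel_translate(2)[OF N] \<epsilon>(2) by (simp add: N_def)
      finally show "measure M (E \<inter> {z. z - v \<in> N}) \<le> m"
        using m by (simp add: emeasure_eq_measure)
    qed
    have "measure M E \<le> measure M (Z \<union> ((E \<inter> {z. z - x \<in> N}) \<union> (E \<inter> {z. z - y \<in> N})))"
      using sub Z small by (intro finite_measure_mono) auto
    also have "\<dots> \<le> measure M Z + (measure M (E \<inter> {z. z - x \<in> N}) + measure M (E \<inter> {z. z - y \<in> N}))"
      using Z small by (intro order_trans[OF measure_Un_le] add_left_mono measure_Un_le)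
        auto
    finally have "m \<le> measure M Z"
      using small(2)[of x] small(2)[of y] by (simp add: m_def)
    then show "ennreal m \<le> emeasure M {z \<in> space M. \<epsilon> \<le> J (x - z) \<and> \<epsilon> \<le> J (z - y)}"
      by (simp add: emeasure_eq_measure Z_def[symmetric] del: space_M)
  qed measurable
  then show ?thesis
    unfolding controlled_on_def E_def[symmetric] using E_sets by simp
qed

text \<open>Finitely many balls of radius \<open>d / 2\<close> cover the domain. A maximal subfamily
  with controlled union meets no remaining piece, so connectedness forces that union to be all of
  \<open>\<Omega>\<close>.\<close>

lemma controlled_on_domain: "controlled_on \<Omega>"
proof -
  have "compact (closure \<Omega>)"
    using \<Omega>_bounded by simp
  then obtain P where P: "finite P" "closure \<Omega> \<subseteq> (\<Union>p\<in>P. ball p (d / 2))"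
    using seq_compact_imp_totally_bounded[OF compact_imp_seq_compact, of "closure \<Omega>"] d_pos
    by (metis half_gt_zero)
  define U where "U A = (\<Union>p\<in>A. \<Omega> \<inter> ball p (d / 2))" for A
  have U_open: "open (U A)" for A
    using \<Omega>_open by (auto simp: U_def)
  have cover: "\<Omega> = U P"
    using P(2) closure_subset by (fastforce simp: U_def)
  \<comment> \<open>Nonemptiness of \<open>U A\<close> later excludes the wrong alternative in the
    connectedness argument.\<close>
  define Q where "Q A \<longleftrightarrow> A \<subseteq> P \<and> U A \<noteq> {} \<and> controlled_on (U A)" for A
  obtain p where p: "p \<in> P" "\<Omega> \<inter> ball p (d / 2) \<noteq> {}"
    using cover \<Omega>_nonempty unfolding U_def by blast
  then have "Q {p}"
    using controlled_on_ball by (simp add: Q_def U_def)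
  moreover have "finite {A. Q A}"
    by (rule finite_subset[of _ "Pow P"]) (auto simp: Q_def P(1))
  ultimately obtain A where A: "Q A" and max: "\<And>B. Q B \<Longrightarrow> A \<subseteq> B \<Longrightarrow> A = B"
    using finite_has_maximal[of "{A. Q A}"] by auto
  \<comment> \<open>A nonempty overlap is open, hence of positive measure, so \<open>q\<close> could
    be added to \<open>A\<close>, contradicting maximality.\<close>
  have disj: "U A \<inter> (\<Omega> \<inter> ball q (d / 2)) = {}" if q: "q \<in> P - A" for q
  proof (rule ccontr)
    let ?E = "\<Omega> \<inter> ball q (d / 2)"
    assume ne: "U A \<inter> ?E \<noteq> {}"
    have "open (U A \<inter> ?E)"
      using U_open \<Omega>_open by (intro open_Int) auto
    then have "0 < emeasure M (U A \<inter> ?E)"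
      using emeasure_lborel_open_pos ne by (subst emeasure_M) auto
    then have "controlled_on (U A \<union> ?E)"
      using A controlled_on_ball by (intro controlled_on_Un) (auto simp: Q_def)
    moreover have "U A \<union> ?E = U (insert q A)"
      by (auto simp: U_def)
    ultimately have "Q (insert q A)"
      using A q by (auto simp: Q_def U_def)
    then show False
      using max[of "insert q A"] q by auto
  qed
  have "U A \<inter> \<Omega> = {} \<or> U (P - A) \<inter> \<Omega> = {}"
  proof (rule connectedD[OF \<Omega>_connected U_open U_open])
    show "U A \<inter> U (P - A) \<inter> \<Omega> = {}"
      using disj by (fastforce simp: U_def)
    show "\<Omega> \<subseteq> U A \<union> U (P - A)"
      using cover by (auto simp: U_def)
  qed
  moreover have "U A \<inter> \<Omega> = U A" "U (P - A) \<inter> \<Omega> = U (P - A)"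
    by (auto simp: U_def)
  ultimately have "U (P - A) = {}"
    using A by (auto simp: Q_def)
  moreover have "U P = U A \<union> U (P - A)"
    using A by (auto simp: Q_def U_def)
  ultimately show ?thesis
    using A cover by (simp add: Q_def)
qed

end

section \<open>Solvability and uniqueness for the stationary problem\<close>

theorem theorem3p1:
  fixes \<Omega> :: "(real^'n) set" and J h :: "real^'n \<Rightarrow> real" and d :: real
  assumes \<Omega>_bdd: "bounded \<Omega>" and \<Omega>_conn: "connected \<Omega>" and \<Omega>_ne: "\<Omega> \<noteq> {}"
      and \<Omega>_smooth: "smooth_domain \<Omega>"
      and J_meas: "J \<in> borel_measurable lborel"
      and J_nonneg: "\<And>x. J x \<ge> 0"
      and J_sym: "\<And>x. J (- x) = J x"
      and J_int: "integrable lborel J" and J_one: "(LINT x|lborel. J x) = 1"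
      and d_pos: "d > 0"
      and J_pos: "\<And>x. norm x < d \<Longrightarrow> J x > 0"
      and J_supp: "\<And>x. norm x \<ge> d \<Longrightarrow> J x = 0"
      and J_L2: "integrable lborel (\<lambda>x. (J x)\<^sup>2)"
      and h_L1: "set_integrable lborel (- \<Omega>) h"
  shows "((\<exists>\<phi>. stationary_solution \<Omega> J h \<phi>) \<longleftrightarrow>
            (LINT x:\<Omega>|lborel. (LINT y:(- \<Omega>)|lborel. J (x - y) * h y)) = 0)
         \<and> (\<forall>\<phi>1 \<phi>2. stationary_solution \<Omega> J h \<phi>1 \<and> stationary_solution \<Omega> J h \<phi>2 \<longrightarrow>
              (\<exists>c::real. AE x in lborel. x \<in> \<Omega> \<longrightarrow> \<phi>1 x = \<phi>2 x + c))"
proof -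
  have \<Omega>_open: "open \<Omega>"
    using \<Omega>_smooth by (simp add: smooth_domain_def)
  interpret nonlocal_domain J d \<Omega>
    using assms \<Omega>_open by unfold_locales auto
  have \<Omega>_M: "\<Omega> \<inter> space lborel \<in> sets lborel"
    using \<Omega>_sets by simp
  obtain C where C: "0 < C" "poincare C"
    using poincare_if_controlled_on_space controlled_on_domain by auto
  have pos: "0 < measure M (space M)"
    using emeasure_lborel_open_pos[OF \<Omega>_open \<Omega>_ne] emeasure_M[of \<Omega>]
    by (metis emeasure_eq_measure ennreal_less_zero_iff order_refl space_M)
  \<comment> \<open>Extending \<open>h\<close> by zero turns \<open>g\<close> into a convolution on
    the whole space.\<close>
  define H where "H y = indicator (- \<Omega>) y * h y" for y
  define g where "g x = (LINT y:(- \<Omega>)|lborel. J (x - y) * h y)" for x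
  have H: "integrable lborel H"
    using h_L1 by (simp add: set_integrable_def H_def[abs_def])
  have g: "g x = (\<integral>y. J (x - y) * H y \<partial>lborel)" for x
    by (simp add: g_def set_lebesgue_integral_def H_def mult.left_commute)
  have g_int: "integrable lborel g"
    using lborel_pair.integrable_fst'[OF convolution_integrable[OF J_int H]] by (simp add: g[abs_def])
  have g_sq: "integrable lborel (\<lambda>x. (g x)\<^sup>2)"
    using convolution_L2[OF J_int J_L2 H] by (simp add: g)
  have restrict: "integrable M f" if "integrable lborel f" for f :: "real^'n \<Rightarrow> real"
    using that \<Omega>_sets integrable_mult_indicator[of \<Omega> lborel f]
    by (subst integrable_restrict_space[OF \<Omega>_M]) simp
  have g_M: "g \<in> borel_measurable M" "integrable M (\<lambda>x. (g x)\<^sup>2)"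
    using restrict[OF g_int] restrict[OF g_sq] by auto
  have g_integral: "(LINT x:\<Omega>|lborel. g x) = (\<integral>x. g x \<partial>M)"
    by (simp add: set_lebesgue_integral_def integral_restrict_space[OF \<Omega>_M])
  \<comment> \<open>Moving the nonlocal term to the other side flips its sign, and integrals and
    null sets pass to the restricted measure, so the abstract results apply.\<close>
  have solution_iff: "stationary_solution \<Omega> J h \<phi> \<longleftrightarrow>
      \<phi> \<in> borel_measurable M \<and> integrable M (\<lambda>x. (\<phi> x)\<^sup>2) \<and> (AE x in M. L \<phi> x = g x)" for \<phi>
  proof -
    have "(LINT y:\<Omega>|lborel. J (x - y) * (\<phi> y - \<phi> x)) = - L \<phi> x" for x
    proof -
      have "(LINT y:\<Omega>|lborel. J (x - y) * (\<phi> y - \<phi> x)) = (\<integral>y. - (J (x - y) * (\<phi> x - \<phi> y)) \<partial>M)"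
        by (simp add: set_lebesgue_integral_def integral_restrict_space[OF \<Omega>_M] algebra_simps)
      then show ?thesis
        unfolding L_def by (simp only: integral_minus)
    qed
    then have "0 = (LINT y:\<Omega>|lborel. J (x - y) * (\<phi> y - \<phi> x)) + (LINT y:(- \<Omega>)|lborel. J (x - y) * h y)
        \<longleftrightarrow> L \<phi> x = g x" for x
      unfolding g_def by auto
    then show ?thesis
      unfolding stationary_solution_def L2_on_def set_borel_measurable_def set_integrable_def
        borel_measurable_restrict_space_iff[OF \<Omega>_M] integrable_restrict_space[OF \<Omega>_M]
        AE_restrict_space_iff[OF \<Omega>_M]
      by simp
  qed
  have "(LINT x:\<Omega>|lborel. g x) = 0" if "stationary_solution \<Omega> J h \<phi>" for \<phi>
  proof -
    have \<phi>: "\<phi> \<in> borel_measurable M" "integrable M (\<lambda>x. (\<phi> x)\<^sup>2)" "AE x in M. L \<phi> x = g x"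
      using that by (auto simp: solution_iff)
    \<comment> \<open>Necessity: \<open>L \<phi>\<close> has integral 0 by symmetry, whatever
      \<open>\<phi>\<close> is.\<close>
    have "(\<integral>x. g x \<partial>M) = (\<integral>x. L \<phi> x \<partial>M)"
      using \<phi>(3) g_M(1) L_measurable[OF \<phi>(1,2)] by (intro integral_cong_AE) auto
    then show ?thesis
      by (simp add: g_integral integral_L[OF \<phi>(1,2)])
  qed
  moreover have "\<exists>\<phi>. stationary_solution \<Omega> J h \<phi>" if "(LINT x:\<Omega>|lborel. g x) = 0"
  proof -
    have "(\<integral>x. g x \<partial>M) = 0"
      using that by (simp add: g_integral)
    from solvable[OF C(2,1) pos g_M this] show ?thesis
      unfolding solution_iff by blast
  qed
  moreover have "\<exists>c. AE x in lborel. x \<in> \<Omega> \<longrightarrow> \<phi>1 x = \<phi>2 x + c"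
    if "stationary_solution \<Omega> J h \<phi>1" "stationary_solution \<Omega> J h \<phi>2" for \<phi>1 \<phi>2
  proof -
    let ?u = "\<lambda>x. \<phi>1 x - \<phi>2 x"
    have 1: "\<phi>1 \<in> borel_measurable M" "integrable M (\<lambda>x. (\<phi>1 x)\<^sup>2)" "AE x in M. L \<phi>1 x = g x"
      and 2: "\<phi>2 \<in> borel_measurable M" "integrable M (\<lambda>x. (\<phi>2 x)\<^sup>2)" "AE x in M. L \<phi>2 x = g x"
      using that by (auto simp: solution_iff)
    have "AE x in M. L ?u x = 0"
      using L_diff[OF 1(1,2) 2(1,2)] 1(3) 2(3) by eventually_elim simp
    then obtain c where "AE x in M. ?u x = c"
      using constant_if_L_zero[of ?u C] L2_diff[OF 1(1) 2(1) 1(2) 2(2)] 1(1) 2(1) C by auto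
    then have "AE x in lborel. x \<in> \<Omega> \<longrightarrow> ?u x = c"
      by (simp add: AE_restrict_space_iff[OF \<Omega>_M])
    then have "AE x in lborel. x \<in> \<Omega> \<longrightarrow> \<phi>1 x = \<phi>2 x + c"
      by eventually_elim auto
    then show ?thesis ..
  qed
  ultimately show ?thesis
    unfolding g_def by blast
qed

end
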